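(* Let $\mathcal{P}\subset\mathbb{R}^2$ be a bounded convex $d$-gon (a bounded convex polygon with exactly $d$ sides) with $d\geq 4$. Then the maximal matrix convex set $\mathcal{W}^{\max}(\mathcal{P})$ over $\mathcal{P}$ has infinitely many free extreme points at level $2$ modulo unitary equivalence; that is, there are infinitely many pairwise non-unitarily-equivalent free extreme points of $\mathcal{W}^{\max}(\mathcal{P})$ in $\mathcal{W}^{\max}(\mathcal{P})(2)$.
   Context: All matrices are real. $SM_n(\mathbb{R})^g$ is the set of $g$-tuples $X=(X_1,\dots,X_g)$ of real symmetric $n\times n$ matrices, and $SM(\mathbb{R})^g=\bigcup_{n\ge 1} SM_n(\mathbb{R})^g$. For $K\subseteq SM(\mathbb{R})^g$, the $n$th level is $K(n)=K\cap SM_n(\mathbb{R})^g$. For $V\in M_{n\times m}(\mathbb{R})$, $V^TXV=(V^TX_1V,\dots,V^TX_gV)$. For $X,Y\in SM_n(\mathbb{R})^g$ write $X\sim_u Y$ (unitarily equivalent) if $U^TXU=Y$ for some real orthogonal $n\times n$ matrix $U$. Direct sums of tuples are taken coordinatewise. A matrix convex combination of elements of $K$ is a finite sum $\sum_{\ell=1}^m V_\ell^TX^\ell V_\ell$ with $X^\ell\in K(n_\ell)$, $V_\ell\in M_{n_\ell\times n}(\mathbb{R})$ and $\sum_{\ell=1}^m V_\ell^TV_\ell=I_n$. $K$ is matrix convex if it contains all matrix convex combinations of its elements. For a closed convex set $C\subseteq\mathbb{R}^g$, the maximal matrix convex set $\mathcal{W}^{\max}(C)$ over $C$ is the set of all $X\in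 SM(\mathbb{R})^g$ satisfying every affine inequality satisfied by $C$: if $a_0+\sum_k a_kx_k\ge 0$ for all $x\in C$, then $a_0I+\sum_k a_kX_k\succeq 0$. A point $X\in K(n)$ of a matrix convex set $K$ is a free extreme point of $K$ if whenever $X=\sum_{\ell=1}^m V_\ell^TY^\ell V_\ell$ is a matrix convex combination of elements $Y^\ell\in K(n_\ell)$ with every $V_\ell\neq 0$, then for each $\ell$ either $n_\ell=n$ and $X\sim_u Y^\ell$, or $n_\ell>n$ and there is $Z^\ell\in K$ with $X\oplus Z^\ell\sim_u Y^\ell$. *)

theory Defs
  imports "HOL-Analysis.Analysis" "Jordan_Normal_Form.Matrix"
begin

no_notation vec_index (infixl \<open>$\<close> 100)

text \<open>
  A matrix tuple is a vector \<open>X :: real mat ^ 'g\<close> whose index type \<open>'g\<close> has \<open>g\<close> elements and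
  whose entries are matrices with a run-time size, so that tuples of all sizes share one type.
\<close>

definition SM_level :: "nat \<Rightarrow> (real mat ^ 'g) set" where
  "SM_level n = {X. \<forall>k. X $ k \<in> carrier_mat n n \<and> transpose_mat (X $ k) = X $ k}"

definition SM :: "(real mat ^ 'g) set" where
  "SM = (\<Union>n\<in>{1..}. SM_level n)"

definition level :: "(real mat ^ 'g) set \<Rightarrow> nat \<Rightarrow> (real mat ^ 'g) set" where
  "level K n = K \<inter> SM_level n"

text \<open>
  The type \<open>real mat\<close> has no zero (the size is not part of the type), so \<^const>\<open>sum\<close> is not
  available on it; finite sums of \<open>n \<times> n\<close> matrices are taken entrywise.
\<close>

definition mat_sum :: "nat \<Rightarrow> 'i set \<Rightarrow> ('i \<Rightarrow> real mat) \<Rightarrow> real mat" where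
  "mat_sum n I A = mat n n (\<lambda>(i, j). \<Sum>l\<in>I. A l $$ (i, j))"

definition tuple_conj :: "real mat \<Rightarrow> real mat ^ 'g \<Rightarrow> real mat ^ 'g" where
  "tuple_conj V X = (\<chi> k. transpose_mat V * X $ k * V)"

definition tuple_sum :: "nat \<Rightarrow> 'i set \<Rightarrow> ('i \<Rightarrow> real mat ^ 'g) \<Rightarrow> real mat ^ 'g" where
  "tuple_sum n I X = (\<chi> k. mat_sum n I (\<lambda>l. X l $ k))"

definition direct_sum :: "real mat ^ 'g \<Rightarrow> real mat ^ 'g \<Rightarrow> real mat ^ 'g" where
  "direct_sum X Z = (\<chi> k. four_block_mat
      (X $ k) (0\<^sub>m (dim_row (X $ k)) (dim_col (Z $ k)))
      (0\<^sub>m (dim_row (Z $ k)) (dim_col (X $ k))) (Z $ k))"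

definition orthogonal_mats :: "nat \<Rightarrow> real mat set" where
  "orthogonal_mats n =
     {U \<in> carrier_mat n n. transpose_mat U * U = 1\<^sub>m n \<and> U * transpose_mat U = 1\<^sub>m n}"

definition unitarily_equiv :: "real mat ^ 'g \<Rightarrow> real mat ^ 'g \<Rightarrow> bool" (infix \<open>\<sim>\<^sub>u\<close> 50) where
  "X \<sim>\<^sub>u Y \<longleftrightarrow> (\<exists>n. X \<in> SM_level n \<and> Y \<in> SM_level n \<and>
     (\<exists>U\<in>orthogonal_mats n. tuple_conj U X = Y))"

text \<open>
  \<open>matrix_convex_comb K n m N V Y X\<close>: \<open>X\<close> is the matrix convex combination of the points
  \<open>Y l\<close> of \<open>K\<close> at level \<open>N l\<close> with coefficients \<open>V l\<close> of size \<open>N l \<times> n\<close>, for \<open>l < m\<close>.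
\<close>

definition matrix_convex_comb ::
  "(real mat ^ 'g) set \<Rightarrow> nat \<Rightarrow> nat \<Rightarrow> (nat \<Rightarrow> nat) \<Rightarrow> (nat \<Rightarrow> real mat) \<Rightarrow>
   (nat \<Rightarrow> real mat ^ 'g) \<Rightarrow> real mat ^ 'g \<Rightarrow> bool" where
  "matrix_convex_comb K n m N V Y X \<longleftrightarrow>
     (\<forall>l<m. Y l \<in> level K (N l) \<and> V l \<in> carrier_mat (N l) n) \<and>
     mat_sum n {..<m} (\<lambda>l. transpose_mat (V l) * V l) = 1\<^sub>m n \<and>
     X = tuple_sum n {..<m} (\<lambda>l. tuple_conj (V l) (Y l))"

definition matrix_convex :: "(real mat ^ 'g) set \<Rightarrow> bool" where
  "matrix_convex K \<longleftrightarrow> K \<subseteq> SM \<and>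
     (\<forall>n\<ge>1. \<forall>m N V Y X. matrix_convex_comb K n m N V Y X \<longrightarrow> X \<in> K)"

definition pos_semidef :: "nat \<Rightarrow> real mat \<Rightarrow> bool" where
  "pos_semidef n A \<longleftrightarrow> A \<in> carrier_mat n n \<and> transpose_mat A = A \<and>
     (\<forall>v\<in>carrier_vec n. scalar_prod v (A *\<^sub>v v) \<ge> 0)"

definition Wmax :: "(real ^ 'g) set \<Rightarrow> (real mat ^ 'g) set" where
  "Wmax C = (\<Union>n\<in>{1..}. {X \<in> SM_level n. \<forall>(a0 :: real) (a :: real ^ 'g).
     (\<forall>x\<in>C. a0 + (\<Sum>k\<in>UNIV. a $ k * x $ k) \<ge> 0) \<longrightarrow>
     pos_semidef n (a0 \<cdot>\<^sub>m 1\<^sub>m n + mat_sum n UNIV (\<lambda>k. a $ k \<cdot>\<^sub>m X $ k))})"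

definition free_extreme_point :: "(real mat ^ 'g) set \<Rightarrow> nat \<Rightarrow> real mat ^ 'g \<Rightarrow> bool" where
  "free_extreme_point K n X \<longleftrightarrow> matrix_convex K \<and> X \<in> level K n \<and>
     (\<forall>m N V Y. matrix_convex_comb K n m N V Y X \<and> (\<forall>l<m. V l \<noteq> 0\<^sub>m (N l) n) \<longrightarrow>
        (\<forall>l<m. (N l = n \<and> X \<sim>\<^sub>u Y l) \<or>
                (N l > n \<and> (\<exists>Z\<in>K. direct_sum X Z \<sim>\<^sub>u Y l))))"

definition convex_polygon :: "nat \<Rightarrow> (real ^ 2) set \<Rightarrow> bool" where
  "convex_polygon d P \<longleftrightarrow> polytope P \<and> aff_dim P = 2 \<and> card {F. F facet_of P} = d"

end

theory Submission
  imports Defs "Jordan_Normal_Form.Determinant"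
begin

no_notation vec_index (infixl \<open>$\<close> 100)
no_notation scalar_prod (infix \<open>\<bullet>\<close> 70)
notation scalar_prod (infix \<open>\<bullet>\<^sub>v\<close> 70)

text \<open>
  A pair of symmetric \<open>2 \<times> 2\<close> matrices has an ellipse as joint numerical range, and it lies in the maximal
  matrix convex set over \<open>P\<close> iff this ellipse lies in \<open>P\<close>. Suppose that the ellipse is nondegenerate and
  touches four sides of \<open>P\<close>. In a matrix convex combination \<open>X = \<Sum> V\<^sub>l\<^sup>T Y\<^sub>l V\<^sub>l\<close> the kernel vector at each of
  these sides is mapped by \<open>V\<^sub>l\<close> into the kernel of the same affine expression in \<open>Y\<^sub>l\<close>; four such linear
  conditions force \<open>Y\<^sub>l V\<^sub>l = V\<^sub>l X\<close>. Hence \<open>V\<^sub>l\<^sup>T V\<^sub>l\<close> commutes with the irreducible pair \<open>X\<close>, \<open>V\<^sub>l\<close> is a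
  multiple of an isometry, and \<open>X\<close> is a direct summand of \<open>Y\<^sub>l\<close>.

  To find infinitely many such ellipses, take a diagonal of \<open>P\<close>. There is a one-parameter family of
  thin ellipses around it that touch the lines of the two sides at each of its end points. Since the diagonal stays
  away from the other sides, so do the thin ellipses.
\<close>

section \<open>Polygons\<close>

text \<open>Four tangencies fit both halves of the argument. For a fixed row index, the rows of
  \<open>Y l $ k * V l - V l * X $ k\<close> with \<open>k = 1, 2\<close> are two plane vectors,
  hence four real unknowns, and every tangent side contributes one linear equation. An ellipse has
  five parameters, so tangency to four lines leaves one of them free. In dual terms the conics
  tangent to four lines form a linear pencil. The pair of end points of the diagonal is a degenerate
  member of it, and the thin ellipses are its neighbours on the side \<open>\<delta> > 0\<close>.
  The two chosen vertices must not lie on a common side: only then are the two sides at one of them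
  and the two at the other four different sides. In a triangle there is no such pair of vertices.
  What remains is to tell the ellipses apart up to unitary equivalence. The determinant of an affine
  expression in \<open>X\<close> is invariant, and for the affine function that measures the
  deviation from the line of the diagonal it equals \<open>- \<delta>\<close>.\<close>

lemma polytope_mem_facet_halfspacesI:
  fixes P :: "'a::euclidean_space set"
  assumes "polytope P" "interior P \<noteq> {}"
    and supp: "\<And>F. F facet_of P \<Longrightarrow> P \<subseteq> {x. a F \<bullet> x \<le> b F} \<and> F = P \<inter> {x. a F \<bullet> x = b F}"
    and x: "\<And>F. F facet_of P \<Longrightarrow> a F \<bullet> x \<le> b F"
  shows "x \<in> P"
proof (rule ccontr)
  assume "x \<notin> P"
  obtain z where z: "z \<in> interior P" using assms by blast
  then have zP: "z \<in> P" using interior_subset by blast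
  \<comment> \<open>The segment from an interior point \<open>z\<close> to \<open>x\<close> leaves
    \<open>P\<close> at a point \<open>y\<close> of some facet \<open>F\<close>. There
    \<open>a F\<close> takes the value \<open>b F\<close>, although it is strictly smaller at
    \<open>z\<close> and at most \<open>b F\<close> at \<open>x\<close>.\<close>
  have "closed_segment z x \<inter> frontier P \<noteq> {}"
    by (rule connected_Int_frontier) (use \<open>x \<notin> P\<close> zP in auto)
  then obtain y where y: "y \<in> closed_segment z x" "y \<in> frontier P" by blast
  have "affine hull P = UNIV"
    using assms(2) affine_hull_nonempty_interior by blast
  then have "y \<in> \<Union> {F. F facet_of P}"
    using y(2) rel_frontier_of_polyhedron[OF polytope_imp_polyhedron[OF assms(1)]]
      rel_frontier_frontier by metis
  then obtain F where F: "F facet_of P" "y \<in> F" by blast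
  have zF: "z \<notin> F"
  proof
    assume "z \<in> F"
    moreover have "z \<in> rel_interior P"
      using z interior_subset_rel_interior by blast
    ultimately show False
      using F(1) rel_boundary_of_polyhedron[OF polytope_imp_polyhedron[OF assms(1)]] by blast
  qed
  have PF: "P \<subseteq> {x. a F \<bullet> x \<le> b F}" and FP: "\<And>w. w \<in> F \<longleftrightarrow> w \<in> P \<and> a F \<bullet> w = b F"
    using supp[OF F(1)] by auto
  have "a F \<bullet> z \<le> b F" "a F \<bullet> z \<noteq> b F" using PF FP zP zF by auto
  then have "a F \<bullet> z < b F" by simp
  moreover have "a F \<bullet> y = b F" using FP F(2) by simp
  moreover obtain t where t: "y = (1 - t) *\<^sub>R z + t *\<^sub>R x" "0 \<le> t" "t \<le> 1"
    using y(1) unfolding closed_segment_def by blast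
  moreover have "t < 1"
  proof (rule ccontr)
    assume "\<not> t < 1"
    then have "y = x" using t by auto
    then show False using F \<open>x \<notin> P\<close> facet_of_imp_subset by blast
  qed
  moreover have "(1 - t) * (a F \<bullet> z) + t * (a F \<bullet> x) < (1 - t) * b F + t * b F"
    using x[OF F(1)] \<open>a F \<bullet> z < b F\<close> \<open>t < 1\<close> t(2)
    by (intro add_less_le_mono mult_strict_left_mono mult_left_mono) auto
  ultimately show False by (simp add: inner_add_right algebra_simps)
qed

text \<open>A facet of a polygon has affine dimension 1, so it is compact, convex and collinear. The
  vertices of \<open>P\<close> on a face are exactly the extreme points of that face, here the two
  ends of the segment.\<close>

lemma polygon_facet_segment:
  fixes P :: "(real^2) set"
  assumes "polytope P" "aff_dim P = 2" "F facet_of P"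
  obtains p q where "p \<noteq> q" "F = closed_segment p q" "{x. x extreme_point_of P} \<inter> F = {p, q}"
proof -
  have dim: "aff_dim F = 1" and face: "F face_of P" and ne: "F \<noteq> {}"
    using assms by (auto simp: facet_of_def)
  obtain p q where pq: "F = closed_segment p q"
  proof (rule compact_convex_collinear_segment[of F])
    show "compact F" "convex F"
      using face assms(1) face_of_imp_compact face_of_imp_convex polytope_imp_compact polytope_imp_convex
      by blast+
    show "collinear F" using dim by (simp add: collinear_aff_dim)
  qed (use ne in auto)
  have "p \<noteq> q" using dim pq by auto
  moreover have "{x. x extreme_point_of P} \<inter> F = {p, q}"
    using extreme_point_of_face[OF face] pq extreme_point_of_segment[of _ p q] by auto
  ultimately show thesis using that pq by blast
qed

text \<open>A facet has only two vertices, its ends, so either facet is the segment from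
  \<open>A\<close> to \<open>B\<close>.\<close>

lemma polygon_facet_eqI:
  fixes P :: "(real^2) set"
  assumes P: "polytope P" "aff_dim P = 2" and F: "F facet_of P" and G: "G facet_of P"
    and "A \<noteq> B" "A extreme_point_of P" "B extreme_point_of P" "{A, B} \<subseteq> F" "{A, B} \<subseteq> G"
  shows "F = G"
proof -
  have "H = closed_segment A B" if H: "H facet_of P" "{A, B} \<subseteq> H" for H
  proof -
    obtain p q where pq: "p \<noteq> q" "H = closed_segment p q" "{x. x extreme_point_of P} \<inter> H = {p, q}"
      using polygon_facet_segment[OF P H(1)] .
    then have "{A, B} \<subseteq> {p, q}" using assms H by blast
    then have "A = p \<and> B = q \<or> A = q \<and> B = p" using \<open>A \<noteq> B\<close> by auto
    then show ?thesis using pq(2) closed_segment_commute by metis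
  qed
  then show ?thesis using assms by metis
qed

lemma polygon_vertex_other:
  fixes P :: "(real^2) set"
  assumes P: "polytope P" "aff_dim P = 2" and F: "F facet_of P" and A: "A extreme_point_of P" "A \<in> F"
  obtains B where "B \<noteq> A" "B extreme_point_of P" "{x. x extreme_point_of P} \<inter> F = {A, B}"
proof -
  obtain p q where "p \<noteq> q" "{x. x extreme_point_of P} \<inter> F = {p, q}"
    using polygon_facet_segment[OF P F] .
  then show thesis
    using that[of p] that[of q] A by (cases "A = p") auto
qed

text \<open>A facet is determined by its two vertices, so there are at most as many facets as pairs
  of vertices; three vertices allow only three pairs.\<close>

lemma polygon_card_vertices:
  fixes P :: "(real^2) set"
  assumes P: "polytope P" "aff_dim P = 2" and d: "4 \<le> card {F. F facet_of P}"
  shows "4 \<le> card {x. x extreme_point_of P}"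
proof (rule ccontr)
  define V where "V = {x. x extreme_point_of P}"
  assume "\<not> ?thesis"
  then have le: "card V \<le> 3" by (simp add: V_def)
  have fin: "finite V"
    unfolding V_def using finite_polyhedron_extreme_points P(1) polytope_imp_polyhedron by blast
  have "inj_on (\<lambda>F. V \<inter> F) {F. F facet_of P}"
  proof (rule inj_onI; clarify)
    fix F G assume FG: "F facet_of P" "G facet_of P" "V \<inter> F = V \<inter> G"
    obtain p q where pq: "p \<noteq> q" "V \<inter> F = {p, q}"
      using polygon_facet_segment[OF P FG(1)] V_def by metis
    show "F = G"
      by (rule polygon_facet_eqI[OF P FG(1,2) pq(1)]) (use pq FG V_def in auto)
  qed
  moreover have "(\<lambda>F. V \<inter> F) ` {F. F facet_of P} \<subseteq> {X. X \<subseteq> V \<and> card X = 2}"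
  proof clarify
    fix F assume "F facet_of P"
    then obtain p q where "p \<noteq> q" "V \<inter> F = {p, q}"
      using polygon_facet_segment[OF P] V_def by metis
    then show "V \<inter> F \<subseteq> V \<and> card (V \<inter> F) = 2"
      by (metis Int_lower1 card_2_iff)
  qed
  moreover have "finite {X. X \<subseteq> V \<and> card X = 2}" using fin by simp
  ultimately have "card {F. F facet_of P} \<le> card V choose 2"
    using card_inj_on_le[of _ "{F. F facet_of P}" "{X. X \<subseteq> V \<and> card X = 2}"] n_subsets[OF fin, of 2]
    by simp
  also have "\<dots> \<le> 3"
  proof -
    have "card V * (card V - 1) \<le> 3 * 2" using le by (intro mult_le_mono) auto
    then show ?thesis by (simp add: choose_two)
  qed
  finally show False using d by simp
qed

text \<open>A proper face of a polyhedron is the intersection of the facets containing it. For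
  \<open>{A}\<close> one facet cannot suffice, since it also contains its other end
  \<open>B\<close>; a second facet has to exclude \<open>B\<close>.\<close>

lemma polygon_vertex_two_facets:
  fixes P :: "(real^2) set"
  assumes P: "polytope P" "aff_dim P = 2" and A: "A extreme_point_of P"
  obtains F G where "F \<noteq> G" "F facet_of P" "G facet_of P" "A \<in> F" "A \<in> G"
proof -
  have "{A} face_of P" using A by (simp add: face_of_singleton)
  moreover have "{A} \<noteq> P" using P(2) by auto
  ultimately have eq: "{A} = \<Inter> {F. F facet_of P \<and> {A} \<subseteq> F}"
    by (intro face_of_polyhedron polytope_imp_polyhedron[OF P(1)]) auto
  have "{F. F facet_of P \<and> {A} \<subseteq> F} \<noteq> {}"
  proof
    assume *: "{F. F facet_of P \<and> {A} \<subseteq> F} = {}"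
    \<comment> \<open>The intersection of the empty family is the whole plane, so any point other
      than \<open>A\<close> gives the contradiction.\<close>
    have "A + 1 \<in> {A}" using * by (subst eq) (simp only: *, simp)
    then show False by simp
  qed
  then obtain F where F: "F facet_of P" "A \<in> F" by blast
  obtain B where B: "B \<noteq> A" "{x. x extreme_point_of P} \<inter> F = {A, B}"
    using polygon_vertex_other[OF P F(1) A F(2)] by metis
  then have "B \<notin> {A}" "B \<in> F" by auto
  then obtain G where "G facet_of P" "A \<in> G" "B \<notin> G"
    using eq by (metis (mono_tags, lifting) InterI insert_subset mem_Collect_eq)
  with F \<open>B \<in> F\<close> show thesis using that by blast
qed

lemma real2_span_of_independent:
  fixes f :: "real^2" assumes "x \<noteq> 0" "y \<noteq> 0" "\<not> (\<exists>c. x = c *\<^sub>R y)"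
  obtains s t where "f = s *\<^sub>R x + t *\<^sub>R y"
proof -
  let ?D = "x $ 1 * y $ 2 - x $ 2 * y $ 1"
  have D: "?D \<noteq> 0"
  proof
    assume D: "?D = 0"
    show False
    proof (cases "y $ 1 = 0")
      case True
      then have "y $ 2 \<noteq> 0" using assms(2) by (auto simp: Finite_Cartesian_Product.vec_eq_iff forall_2)
      then have "x = (x $ 2 / y $ 2) *\<^sub>R y"
        using True D by (auto simp: Finite_Cartesian_Product.vec_eq_iff forall_2)
      then show False using assms(3) by blast
    next
      case False
      then have "x = (x $ 1 / y $ 1) *\<^sub>R y"
        using D by (auto simp: Finite_Cartesian_Product.vec_eq_iff forall_2 field_simps)
      then show False using assms(3) by blast
    qed
  qed
  \<comment> \<open>Cramer's rule, with \<open>?D\<close> the determinant of the columns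
    \<open>x\<close>, \<open>y\<close>.\<close>
  have "f = ((f $ 1 * y $ 2 - f $ 2 * y $ 1) / ?D) *\<^sub>R x + ((x $ 1 * f $ 2 - x $ 2 * f $ 1) / ?D) *\<^sub>R y"
    using D by (simp add: Finite_Cartesian_Product.vec_eq_iff forall_2 divide_simps) (simp add: algebra_simps)
  then show thesis using that by blast
qed

text \<open>Each facet normal annihilates its own edge vector at \<open>A\<close> and is negative on
  the other two. Writing \<open>f3 = s f1 + t f2\<close>, the normals \<open>a1\<close> and
  \<open>a2\<close> force \<open>s, t > 0\<close>, so the third edge would run between the other
  two; then \<open>a3\<close> is negative on \<open>f3\<close>, a contradiction.\<close>

lemma polygon_vertex_at_most_two_facets:
  fixes P :: "(real^2) set"
  assumes P: "polytope P" "aff_dim P = 2" and A: "A extreme_point_of P"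
    and F: "F facet_of P" "A \<in> F" and G: "G facet_of P" "A \<in> G" and H: "H facet_of P" "A \<in> H"
    and ne: "F \<noteq> G" "F \<noteq> H" "G \<noteq> H"
  shows False
proof -
  have poly: "polyhedron P" using P(1) polytope_imp_polyhedron by blast
  obtain a1 b1 where h1: "P \<subseteq> {x. a1 \<bullet> x \<le> b1}" "F = P \<inter> {x. a1 \<bullet> x = b1}"
    using facet_of_polyhedron[OF poly F(1)] by metis
  obtain a2 b2 where h2: "P \<subseteq> {x. a2 \<bullet> x \<le> b2}" "G = P \<inter> {x. a2 \<bullet> x = b2}"
    using facet_of_polyhedron[OF poly G(1)] by metis
  obtain a3 b3 where h3: "P \<subseteq> {x. a3 \<bullet> x \<le> b3}" "H = P \<inter> {x. a3 \<bullet> x = b3}"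
    using facet_of_polyhedron[OF poly H(1)] by metis
  obtain B1 where B1: "B1 \<noteq> A" "B1 extreme_point_of P" "{x. x extreme_point_of P} \<inter> F = {A, B1}"
    using polygon_vertex_other[OF P F(1) A F(2)] .
  obtain B2 where B2: "B2 \<noteq> A" "B2 extreme_point_of P" "{x. x extreme_point_of P} \<inter> G = {A, B2}"
    using polygon_vertex_other[OF P G(1) A G(2)] .
  obtain B3 where B3: "B3 \<noteq> A" "B3 extreme_point_of P" "{x. x extreme_point_of P} \<inter> H = {A, B3}"
    using polygon_vertex_other[OF P H(1) A H(2)] .
  have in_P: "B1 \<in> P" "B2 \<in> P" "B3 \<in> P" "A \<in> P"
    using A B1(2) B2(2) B3(2) by (auto simp: extreme_point_of_def)
  have mem: "B1 \<in> F" "B2 \<in> G" "B3 \<in> H" using B1 B2 B3 by auto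
  have eqI: "K = L" if "K facet_of P" "L facet_of P" "A \<in> K" "A \<in> L" "B \<noteq> A"
    "B extreme_point_of P" "B \<in> K" "B \<in> L" for K L B
    by (rule polygon_facet_eqI[OF P that(1,2) that(5,6) A]) (use that in auto)
  have notin: "B2 \<notin> F" "B3 \<notin> F" "B1 \<notin> G" "B3 \<notin> G" "B1 \<notin> H" "B2 \<notin> H"
    using eqI[OF F(1) G(1) F(2) G(2)] eqI[OF F(1) H(1) F(2) H(2)] eqI[OF G(1) H(1) G(2) H(2)]
      B1 B2 B3 ne mem by blast+
  define f1 f2 f3 where "f1 = B1 - A" and "f2 = B2 - A" and "f3 = B3 - A"
  have eqs: "a1 \<bullet> f1 = 0" "a2 \<bullet> f2 = 0" "a3 \<bullet> f3 = 0"
    using h1 h2 h3 mem F(2) G(2) H(2) unfolding f1_def f2_def f3_def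
    by (auto simp: inner_diff_right)
  have "a1 \<bullet> B2 < b1" "a1 \<bullet> B3 < b1" "a1 \<bullet> A = b1" using h1 in_P notin F by fastforce+
  then have n1: "a1 \<bullet> f2 < 0" "a1 \<bullet> f3 < 0" by (auto simp: f2_def f3_def inner_diff_right)
  have "a2 \<bullet> B1 < b2" "a2 \<bullet> B3 < b2" "a2 \<bullet> A = b2" using h2 in_P notin G by fastforce+
  then have n2: "a2 \<bullet> f1 < 0" "a2 \<bullet> f3 < 0" by (auto simp: f1_def f3_def inner_diff_right)
  have "a3 \<bullet> B1 < b3" "a3 \<bullet> B2 < b3" "a3 \<bullet> A = b3" using h3 in_P notin H by fastforce+
  then have n3: "a3 \<bullet> f1 < 0" "a3 \<bullet> f2 < 0" by (auto simp: f1_def f2_def inner_diff_right)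
  have "f1 \<noteq> 0" "f2 \<noteq> 0" using B1(1) B2(1) by (auto simp: f1_def f2_def)
  moreover have "\<not> (\<exists>c. f1 = c *\<^sub>R f2)"
    using eqs(2) n2(1) by (metis inner_scaleR_right mult_zero_right less_irrefl)
  ultimately obtain s t where st: "f3 = s *\<^sub>R f1 + t *\<^sub>R f2"
    by (rule real2_span_of_independent)
  have "a1 \<bullet> f3 = t * (a1 \<bullet> f2)" "a2 \<bullet> f3 = s * (a2 \<bullet> f1)" "a3 \<bullet> f3 = s * (a3 \<bullet> f1) + t * (a3 \<bullet> f2)"
    unfolding st using eqs by (simp_all add: inner_add_right)
  then have "t * (a1 \<bullet> f2) < 0" "s * (a2 \<bullet> f1) < 0" and sum0: "s * (a3 \<bullet> f1) + t * (a3 \<bullet> f2) = 0"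
    using n1(2) n2(2) eqs(3) by auto
  then have "t > 0" "s > 0"
    using n1(1) n2(1) by (auto simp: mult_less_0_iff)
  then show False using n3 mult_pos_neg[of s "a3 \<bullet> f1"] mult_pos_neg[of t "a3 \<bullet> f2"] sum0 by linarith
qed

lemma polygon_vertex_facets:
  fixes P :: "(real^2) set"
  assumes P: "polytope P" "aff_dim P = 2" and A: "A extreme_point_of P"
  obtains F G where "F \<noteq> G" "{H. H facet_of P \<and> A \<in> H} = {F, G}"
proof -
  obtain F G where FG: "F \<noteq> G" "F facet_of P" "G facet_of P" "A \<in> F" "A \<in> G"
    using polygon_vertex_two_facets[OF P A] .
  then have "{H. H facet_of P \<and> A \<in> H} = {F, G}"
    using polygon_vertex_at_most_two_facets[OF P A] by blast
  with FG show thesis using that by blast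
qed

text \<open>The two sides at \<open>A\<close> contain only the vertices \<open>A\<close>,
  \<open>B1\<close>, \<open>B2\<close>. Any fourth vertex \<open>C\<close> therefore shares no side
  with \<open>A\<close>.\<close>

lemma polygon_diagonal:
  fixes P :: "(real^2) set"
  assumes P: "polytope P" "aff_dim P = 2" and d: "4 \<le> card {F. F facet_of P}"
  obtains A C F1 F2 G1 G2
  where "A \<in> P" "C \<in> P" "F1 \<noteq> F2" "{H. H facet_of P \<and> A \<in> H} = {F1, F2}"
    "G1 \<noteq> G2" "{H. H facet_of P \<and> C \<in> H} = {G1, G2}"
    "\<And>H. H facet_of P \<Longrightarrow> A \<notin> H \<or> C \<notin> H"
proof -
  define V where "V = {x. x extreme_point_of P}"
  have card: "4 \<le> card V" unfolding V_def using polygon_card_vertices[OF P d] .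
  then obtain A where "A \<in> V" by fastforce
  then have A: "A extreme_point_of P" by (simp add: V_def)
  obtain F1 F2 where F: "F1 \<noteq> F2" "{H. H facet_of P \<and> A \<in> H} = {F1, F2}"
    using polygon_vertex_facets[OF P A] .
  have F12: "F1 facet_of P" "A \<in> F1" "F2 facet_of P" "A \<in> F2" using F(2) by blast+
  obtain B1 where B1: "V \<inter> F1 = {A, B1}"
    using polygon_vertex_other[OF P F12(1) A F12(2)] unfolding V_def by metis
  obtain B2 where B2: "V \<inter> F2 = {A, B2}"
    using polygon_vertex_other[OF P F12(3) A F12(4)] unfolding V_def by metis
  have "card {A, B1, B2} \<le> 3" by (simp add: card_insert_le_m1)
  then have "\<not> V \<subseteq> {A, B1, B2}" using card card_mono[of "{A, B1, B2}" V] by auto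
  then obtain C where C: "C \<in> V" "C \<notin> {A, B1, B2}" by blast
  then have Cex: "C extreme_point_of P" by (simp add: V_def)
  obtain G1 G2 where G: "G1 \<noteq> G2" "{H. H facet_of P \<and> C \<in> H} = {G1, G2}"
    using polygon_vertex_facets[OF P Cex] .
  have "A \<notin> H \<or> C \<notin> H" if "H facet_of P" for H
    using that F(2) B1 B2 C by blast
  moreover have "A \<in> P" "C \<in> P" using A Cex by (auto simp: extreme_point_of_def)
  ultimately show thesis using that[OF _ _ F G] by simp
qed

section \<open>Binary cubic forms and tangent ellipses\<close>

lemma quadratic_three_roots:
  fixes k :: real
  assumes "\<And>t. t \<in> {a, b, c} \<Longrightarrow> k + l * t + m * t^2 = 0" "distinct [a, b, c]"
  shows "k = 0" "l = 0" "m = 0"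
proof -
  have e: "k + l * a + m * a^2 = 0" "k + l * b + m * b^2 = 0" "k + l * c + m * c^2 = 0"
    using assms(1) by auto
  have "(a - b) * (l + m * (a + b)) = 0" "(a - c) * (l + m * (a + c)) = 0"
    using e by (simp_all add: algebra_simps power2_eq_square)
  then have f: "l + m * (a + b) = 0" "l + m * (a + c) = 0" using assms(2) by auto
  then have "m * (b - c) = 0" unfolding ring_distribs by linarith
  then show "m = 0" using assms(2) by auto
  then show "l = 0" using f by simp
  then show "k = 0" using e \<open>m = 0\<close> by simp
qed

lemma cubic_four_roots:
  fixes k :: real
  assumes "\<And>t. t \<in> {a, b, c, d} \<Longrightarrow> k + l * t + m * t^2 + n * t^3 = 0" "distinct [a, b, c, d]"
  shows "k = 0" "l = 0" "m = 0" "n = 0"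
proof -
  have q: "(l + m * d + n * d^2) + (m + n * d) * t + n * t^2 = 0" if "t \<in> {a, b, c}" for t
  proof -
    have "k + l * t + m * t^2 + n * t^3 = 0" "k + l * d + m * d^2 + n * d^3 = 0"
      using assms(1) that by auto
    then have "(t - d) * ((l + m * d + n * d^2) + (m + n * d) * t + n * t^2) = 0"
      by (simp add: algebra_simps power2_eq_square power3_eq_cube)
    moreover have "t \<noteq> d" using that assms(2) by auto
    ultimately show ?thesis by simp
  qed
  have dist: "distinct [a, b, c]" using assms(2) by simp
  note z = quadratic_three_roots[OF q dist]
  show n0: "n = 0" using z by simp
  show m0: "m = 0" using z n0 by simp
  show l0: "l = 0" using z n0 m0 by simp
  show "k = 0" using assms(1)[of a] n0 m0 l0 by simp
qed

text \<open>Normalising a direction \<open>(x, y)\<close> with \<open>x \<noteq> 0\<close> to the slope \<open>y / x\<close> leaves out at most one of the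
  four directions, and that one kills the coefficient of \<open>y\<^sup>3\<close>.\<close>

lemma binary_cubic_four_zeros:
  fixes k l m n :: real and x y :: "nat \<Rightarrow> real"
  assumes zero: "\<And>i. i < 4 \<Longrightarrow> k * x i^3 + l * x i^2 * y i + m * x i * y i^2 + n * y i^3 = 0"
    and indep: "\<And>i j. i < 4 \<Longrightarrow> j < 4 \<Longrightarrow> i \<noteq> j \<Longrightarrow> x i * y j \<noteq> x j * y i"
  shows "k = 0 \<and> l = 0 \<and> m = 0 \<and> n = 0"
proof -
  define t where "t i = y i / x i" for i
  have slope: "k + l * t i + m * t i^2 + n * t i^3 = 0" if "i < 4" "x i \<noteq> 0" for i
  proof -
    have "x i^3 * (k + l * t i + m * t i^2 + n * t i^3)
        = k * x i^3 + l * x i^2 * y i + m * x i * y i^2 + n * y i^3"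
      using that(2) by (simp add: t_def field_simps power2_eq_square power3_eq_cube)
    then show ?thesis using zero[OF that(1)] that(2) by simp
  qed
  have t_ne: "t i \<noteq> t j" if "i < 4" "j < 4" "i \<noteq> j" "x i \<noteq> 0" "x j \<noteq> 0" for i j
    using indep[OF that(1-3)] that(4,5) by (simp add: t_def field_simps)
  show ?thesis
  proof (cases "\<exists>i<4. x i = 0")
    case False
    then have nz: "x 0 \<noteq> 0" "x 1 \<noteq> 0" "x 2 \<noteq> 0" "x 3 \<noteq> 0" by auto
    have "distinct [t 0, t 1, t 2, t 3]"
      using nz t_ne by simp
    moreover have "k + l * z + m * z^2 + n * z^3 = 0" if "z \<in> {t 0, t 1, t 2, t 3}" for z
      using that slope nz by auto
    ultimately show ?thesis
      using cubic_four_roots[of "t 0" "t 1" "t 2" "t 3" k l m n] by blast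
  next
    case True
    then obtain i where i: "i < 4" "x i = 0" by blast
    have nz: "x j \<noteq> 0" if "j < 4" "j \<noteq> i" for j
      using indep[of i j] that i by auto
    have "y i \<noteq> 0"
    proof
      assume "y i = 0"
      obtain j :: nat where "j < 4" "j \<noteq> i" by (rule that[of "if i = 0 then 1 else 0"]) auto
      then show False using indep[of i j] i \<open>y i = 0\<close> by auto
    qed
    then have n0: "n = 0" using zero[of i] i by simp
    \<comment> \<open>The three witnesses run through the indices below 4 other than
      \<open>i\<close>, in increasing order.\<close>
    obtain a b c where abc: "a < 4" "b < 4" "c < 4" "distinct [a, b, c]" "i \<notin> {a, b, c}"
      by (rule that[of "if i = 0 then 1 else 0" "if i \<le> 1 then 2 else 1" "if i \<le> 2 then 3 else 2"])
        (use i in auto)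
    have "distinct [t a, t b, t c]" using abc t_ne nz by auto
    moreover have "k + l * z + m * z^2 = 0" if "z \<in> {t a, t b, t c}" for z
      using that slope n0 nz abc by auto
    ultimately show ?thesis
      using quadratic_three_roots[of "t a" "t b" "t c" k l m] n0 by blast
  qed
qed

text \<open>The ellipse with centre \<open>(p, q)\<close> and support function
  \<open>(g, h) \<mapsto> g p + h q + sqrt (g\<^sup>2 u + 2 g h w + h\<^sup>2 \<epsilon>)\<close> touches the line \<open>1 + x + s y = 0\<close> iff
  \<open>u + 2 s w + s\<^sup>2 \<epsilon> = (1 + p + s q)\<^sup>2\<close>. Requiring this for \<open>s = s1, s2\<close> prescribes the roots of a quadratic
  polynomial in \<open>s\<close> with leading coefficient \<open>\<delta> = \<epsilon> - q\<^sup>2\<close>; the same for the lines \<open>1 - x + t y = 0\<close> at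
  the other end point then determines \<open>p, q, u, w\<close> linearly from \<open>\<delta>\<close>. For \<open>\<delta> = 0\<close> the ellipse degenerates
  to the segment from \<open>(-1, 0)\<close> to \<open>(1, 0)\<close>.\<close>

lemma ellipses_tangent_to_four_lines:
  fixes s1 s2 t1 t2 :: real and Q :: "(real \<times> real \<times> real) set"
  assumes "finite Q" and Q: "\<And>r g h. (r, g, h) \<in> Q \<Longrightarrow> \<bar>g\<bar> < r"
  obtains \<delta>0 :: real and p q u w :: "real \<Rightarrow> real" where "0 < \<delta>0"
    "\<And>\<delta>. 0 < \<delta> \<Longrightarrow> \<delta> < \<delta>0 \<Longrightarrow> 0 < u \<delta> \<and> (w \<delta>)\<^sup>2 < u \<delta> * (\<delta> + (q \<delta>)\<^sup>2)"
    "\<And>\<delta> s. 0 < \<delta> \<Longrightarrow> \<delta> < \<delta>0 \<Longrightarrow> s \<in> {s1, s2} \<Longrightarrow> 0 < 1 + p \<delta> + s * q \<delta> \<and>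
       u \<delta> + 2 * s * w \<delta> + s\<^sup>2 * (\<delta> + (q \<delta>)\<^sup>2) = (1 + p \<delta> + s * q \<delta>)\<^sup>2"
    "\<And>\<delta> t. 0 < \<delta> \<Longrightarrow> \<delta> < \<delta>0 \<Longrightarrow> t \<in> {t1, t2} \<Longrightarrow> 0 < 1 - p \<delta> + t * q \<delta> \<and>
       u \<delta> - 2 * t * w \<delta> + t\<^sup>2 * (\<delta> + (q \<delta>)\<^sup>2) = (1 - p \<delta> + t * q \<delta>)\<^sup>2"
    "\<And>\<delta> r g h. 0 < \<delta> \<Longrightarrow> \<delta> < \<delta>0 \<Longrightarrow> (r, g, h) \<in> Q \<Longrightarrow> 0 < r + g * p \<delta> + h * q \<delta> \<and>
       g\<^sup>2 * u \<delta> + 2 * g * h * w \<delta> + h\<^sup>2 * (\<delta> + (q \<delta>)\<^sup>2) < (r + g * p \<delta> + h * q \<delta>)\<^sup>2"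
proof -
  \<comment> \<open>The lines at the end \<open>(-1, 0)\<close> give
    \<open>u = (1 + p)^2 + \<delta> s1 s2\<close> and
    \<open>w = q (1 + p) - \<delta> (s1 + s2) / 2\<close>; those at \<open>(1, 0)\<close> give
    \<open>u = (1 - p)^2 + \<delta> t1 t2\<close> and
    \<open>w = \<delta> (t1 + t2) / 2 - q (1 - p)\<close>. Equating the two values of
    \<open>u\<close> yields \<open>p = \<delta> b\<close>, and equating those of \<open>w\<close>
    yields \<open>q = \<delta> c\<close>.\<close>
  define b c where "b = (t1 * t2 - s1 * s2) / 4" and "c = (s1 + s2 + t1 + t2) / 4"
  define p q u w :: "real \<Rightarrow> real" where "p \<delta> = \<delta> * b" and "q \<delta> = \<delta> * c"
    and "u \<delta> = (1 + p \<delta>)\<^sup>2 + \<delta> * (s1 * s2)"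
    and "w \<delta> = q \<delta> * (1 + p \<delta>) - \<delta> * (s1 + s2) / 2" for \<delta>
  let ?F = "at_right (0::real)"
  have id: "((\<lambda>\<delta>. \<delta>) \<longlongrightarrow> 0) ?F" by (rule tendsto_ident_at)
  have p: "(p \<longlongrightarrow> 0) ?F" and q: "(q \<longlongrightarrow> 0) ?F"
    unfolding p_def q_def by (auto intro!: tendsto_eq_intros id)
  have u: "(u \<longlongrightarrow> 1) ?F" unfolding u_def by (auto intro!: tendsto_eq_intros id p)
  have w: "(w \<longlongrightarrow> 0) ?F" unfolding w_def by (auto intro!: tendsto_eq_intros id p q)
  have pos: "eventually (\<lambda>\<delta>. 0 < f \<delta>) ?F" if "(f \<longlongrightarrow> l) ?F" "0 < l" for f :: "real \<Rightarrow> real" and l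
    using order_tendstoD(1)[OF that] .
  \<comment> \<open>The quantity that must be positive, \<open>u (\<delta> + q^2) - w^2\<close>,
    tends to 0. Since \<open>q\<close> and \<open>w\<close> are multiples of
    \<open>\<delta>\<close>, one factor \<open>\<delta>\<close> splits off, and the quotient has the
    positive limit 1.\<close>
  have "((\<lambda>\<delta>. u \<delta> * (1 + \<delta> * c\<^sup>2) - \<delta> * (c * (1 + p \<delta>) - (s1 + s2) / 2)\<^sup>2) \<longlongrightarrow> 1) ?F"
    by (auto intro!: tendsto_eq_intros id p u)
  then have ev1: "eventually (\<lambda>\<delta>. 0 < u \<delta> * (1 + \<delta> * c\<^sup>2) - \<delta> * (c * (1 + p \<delta>) - (s1 + s2) / 2)\<^sup>2) ?F"
    by (rule pos) simp
  have ev2: "eventually (\<lambda>\<delta>. 0 < 1 + p \<delta> + s * q \<delta>) ?F" for s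
    by (rule pos[where l = 1]) (auto intro!: tendsto_eq_intros p q)
  have ev3: "eventually (\<lambda>\<delta>. 0 < 1 - p \<delta> + t * q \<delta>) ?F" for t
    by (rule pos[where l = 1]) (auto intro!: tendsto_eq_intros p q)
  \<comment> \<open>In the limit the ellipse is the segment from \<open>(-1, 0)\<close> to
    \<open>(1, 0)\<close>, on which \<open>r + g x + h y\<close> is at least
    \<open>r - \<bar>g\<bar> > 0\<close>. The limits \<open>r\<close> and \<open>r^2 - g^2\<close>
    are therefore positive.\<close>
  have ev4: "eventually (\<lambda>\<delta>. 0 < r + g * p \<delta> + h * q \<delta> \<and> 0 < (r + g * p \<delta> + h * q \<delta>)\<^sup>2
      - (g\<^sup>2 * u \<delta> + 2 * g * h * w \<delta> + h\<^sup>2 * (\<delta> + (q \<delta>)\<^sup>2))) ?F"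
    if "(r, g, h) \<in> Q" for r g h
  proof (rule eventually_conj)
    have "\<bar>g\<bar> < r" using Q that by blast
    then have "0 < r" "0 < r\<^sup>2 - g\<^sup>2" using abs_square_less_1 power2_strict_mono[of g r] by auto
    show "eventually (\<lambda>\<delta>. 0 < r + g * p \<delta> + h * q \<delta>) ?F"
      by (rule pos[OF _ \<open>0 < r\<close>]) (auto intro!: tendsto_eq_intros p q)
    show "eventually (\<lambda>\<delta>. 0 < (r + g * p \<delta> + h * q \<delta>)\<^sup>2
      - (g\<^sup>2 * u \<delta> + 2 * g * h * w \<delta> + h\<^sup>2 * (\<delta> + (q \<delta>)\<^sup>2))) ?F"
      by (rule pos[OF _ \<open>0 < r\<^sup>2 - g\<^sup>2\<close>]) (auto intro!: tendsto_eq_intros p q u w id)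
  qed
  have ev4': "eventually (\<lambda>\<delta>. \<forall>(r, g, h)\<in>Q. 0 < r + g * p \<delta> + h * q \<delta> \<and> 0 < (r + g * p \<delta> + h * q \<delta>)\<^sup>2
      - (g\<^sup>2 * u \<delta> + 2 * g * h * w \<delta> + h\<^sup>2 * (\<delta> + (q \<delta>)\<^sup>2))) ?F"
    by (rule eventually_ball_finite[OF assms(1)]) (use ev4 in auto)
  have ev0: "eventually (\<lambda>\<delta>. 0 < u \<delta>) ?F" by (rule pos[OF u]) simp
  have "eventually (\<lambda>\<delta>. 0 < u \<delta> \<and>
      0 < u \<delta> * (1 + \<delta> * c\<^sup>2) - \<delta> * (c * (1 + p \<delta>) - (s1 + s2) / 2)\<^sup>2 \<and>
      0 < 1 + p \<delta> + s1 * q \<delta> \<and> 0 < 1 + p \<delta> + s2 * q \<delta> \<and>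
      0 < 1 - p \<delta> + t1 * q \<delta> \<and> 0 < 1 - p \<delta> + t2 * q \<delta> \<and>
      (\<forall>(r, g, h)\<in>Q. 0 < r + g * p \<delta> + h * q \<delta> \<and> 0 < (r + g * p \<delta> + h * q \<delta>)\<^sup>2
      - (g\<^sup>2 * u \<delta> + 2 * g * h * w \<delta> + h\<^sup>2 * (\<delta> + (q \<delta>)\<^sup>2)))) ?F"
    by (intro eventually_conj ev0 ev1 ev2 ev3 ev4')
  then obtain \<delta>0 where "0 < \<delta>0" and ev: "\<And>\<delta>. 0 < \<delta> \<Longrightarrow> \<delta> < \<delta>0 \<Longrightarrow> 0 < u \<delta> \<and>
      0 < u \<delta> * (1 + \<delta> * c\<^sup>2) - \<delta> * (c * (1 + p \<delta>) - (s1 + s2) / 2)\<^sup>2 \<and>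
      0 < 1 + p \<delta> + s1 * q \<delta> \<and> 0 < 1 + p \<delta> + s2 * q \<delta> \<and>
      0 < 1 - p \<delta> + t1 * q \<delta> \<and> 0 < 1 - p \<delta> + t2 * q \<delta> \<and>
      (\<forall>(r, g, h)\<in>Q. 0 < r + g * p \<delta> + h * q \<delta> \<and> 0 < (r + g * p \<delta> + h * q \<delta>)\<^sup>2
      - (g\<^sup>2 * u \<delta> + 2 * g * h * w \<delta> + h\<^sup>2 * (\<delta> + (q \<delta>)\<^sup>2)))"
    unfolding eventually_at_right_field by blast
  show thesis
  proof (rule that[OF \<open>0 < \<delta>0\<close>, where p = p and q = q and u = u and w = w])
    fix \<delta> :: real assume \<delta>: "0 < \<delta>" "\<delta> < \<delta>0"
    have "u \<delta> * (\<delta> + (q \<delta>)\<^sup>2) - (w \<delta>)\<^sup>2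
        = \<delta> * (u \<delta> * (1 + \<delta> * c\<^sup>2) - \<delta> * (c * (1 + p \<delta>) - (s1 + s2) / 2)\<^sup>2)"
      unfolding w_def q_def by (simp add: field_simps power2_eq_square)
    also have "\<dots> > 0" using ev[OF \<delta>] \<delta> by simp
    finally show "0 < u \<delta> \<and> (w \<delta>)\<^sup>2 < u \<delta> * (\<delta> + (q \<delta>)\<^sup>2)" using ev[OF \<delta>] by simp
  next
    fix \<delta> s :: real assume \<delta>: "0 < \<delta>" "\<delta> < \<delta>0" and s: "s \<in> {s1, s2}"
    have "(s - s1) * (s - s2) = 0" using s by auto
    moreover have "u \<delta> + 2 * s * w \<delta> + s\<^sup>2 * (\<delta> + (q \<delta>)\<^sup>2) - (1 + p \<delta> + s * q \<delta>)\<^sup>2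
        = \<delta> * ((s - s1) * (s - s2))"
      unfolding u_def w_def by (simp add: field_simps power2_eq_square)
    ultimately show "0 < 1 + p \<delta> + s * q \<delta> \<and>
       u \<delta> + 2 * s * w \<delta> + s\<^sup>2 * (\<delta> + (q \<delta>)\<^sup>2) = (1 + p \<delta> + s * q \<delta>)\<^sup>2"
      using ev[OF \<delta>] s by auto
  next
    fix \<delta> t :: real assume \<delta>: "0 < \<delta>" "\<delta> < \<delta>0" and t: "t \<in> {t1, t2}"
    \<comment> \<open>The same \<open>u\<close> and \<open>w\<close> written from the other end; the
      choice of \<open>b\<close> and \<open>c\<close> enters here.\<close>
    have uu: "u \<delta> = (1 - p \<delta>)\<^sup>2 + \<delta> * (t1 * t2)"
      unfolding u_def p_def b_def by (simp add: field_simps power2_eq_square)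
    have ww: "w \<delta> = \<delta> * (t1 + t2) / 2 - q \<delta> * (1 - p \<delta>)"
      unfolding w_def q_def c_def by (simp add: field_simps)
    have "u \<delta> - 2 * t * w \<delta> + t\<^sup>2 * (\<delta> + (q \<delta>)\<^sup>2) - (1 - p \<delta> + t * q \<delta>)\<^sup>2
        = \<delta> * ((t - t1) * (t - t2))"
      unfolding uu ww by (simp add: field_simps power2_eq_square)
    moreover have "(t - t1) * (t - t2) = 0" using t by auto
    ultimately show "0 < 1 - p \<delta> + t * q \<delta> \<and>
       u \<delta> - 2 * t * w \<delta> + t\<^sup>2 * (\<delta> + (q \<delta>)\<^sup>2) = (1 - p \<delta> + t * q \<delta>)\<^sup>2"
      using ev[OF \<delta>] t by auto
  next
    fix \<delta> r g h :: real assume \<delta>: "0 < \<delta>" "\<delta> < \<delta>0" and "(r, g, h) \<in> Q"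
    then show "0 < r + g * p \<delta> + h * q \<delta> \<and>
       g\<^sup>2 * u \<delta> + 2 * g * h * w \<delta> + h\<^sup>2 * (\<delta> + (q \<delta>)\<^sup>2) < (r + g * p \<delta> + h * q \<delta>)\<^sup>2"
      using ev[OF \<delta>] by fastforce
  qed
qed

section \<open>Free extreme points of maximal matrix convex sets\<close>

lemma scalar_prod_mult_mat_vec_sum:
  assumes "A \<in> carrier_mat n m" "v \<in> carrier_vec m"
  shows "w \<bullet>\<^sub>v (A *\<^sub>v v) = (\<Sum>i<n. \<Sum>j<m. vec_index w i * A $$ (i, j) * vec_index v j)"
proof -
  have "vec_index (A *\<^sub>v v) i = (\<Sum>j<m. A $$ (i, j) * vec_index v j)" if "i < n" for i
    using assms that by (simp add: scalar_prod_def atLeast0LessThan)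
  then show ?thesis
    using assms by (simp add: scalar_prod_def[of w] atLeast0LessThan sum_distrib_left mult.assoc)
qed

lemma scalar_prod_mult_mat_vec_symmetric:
  fixes A :: "real mat"
  assumes "A \<in> carrier_mat n n" "transpose_mat A = A" "v \<in> carrier_vec n" "w \<in> carrier_vec n"
  shows "v \<bullet>\<^sub>v (A *\<^sub>v w) = w \<bullet>\<^sub>v (A *\<^sub>v v)"
  using transpose_vec_mult_scalar[of A n n w v] comm_scalar_prod[of w n "A *\<^sub>v v"] assms by auto

lemma scalar_prod_self_nonneg: "0 \<le> v \<bullet>\<^sub>v (v :: real vec)"
  by (auto simp: scalar_prod_def intro!: sum_nonneg)

lemma scalar_prod_self_eq_0:
  fixes v :: "real vec"
  assumes "v \<in> carrier_vec n" "v \<bullet>\<^sub>v v = 0"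
  shows "v = 0\<^sub>v n"
proof -
  have "\<forall>i\<in>{0..<n}. vec_index v i * vec_index v i = 0"
    using assms by (subst sum_nonneg_eq_0_iff[symmetric]) (auto simp: scalar_prod_def)
  then show ?thesis using assms by (intro eq_vecI) auto
qed

lemma scalar_prod_mat_sum:
  assumes A: "\<And>l. l \<in> I \<Longrightarrow> A l \<in> carrier_mat n n" and v: "v \<in> carrier_vec n"
  shows "w \<bullet>\<^sub>v (mat_sum n I A *\<^sub>v v) = (\<Sum>l\<in>I. w \<bullet>\<^sub>v (A l *\<^sub>v v))"
proof -
  have "mat_sum n I A \<in> carrier_mat n n" by (simp add: mat_sum_def)
  then have "w \<bullet>\<^sub>v (mat_sum n I A *\<^sub>v v)
      = (\<Sum>i<n. \<Sum>j<n. vec_index w i * (\<Sum>l\<in>I. A l $$ (i, j)) * vec_index v j)"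
    using v by (subst scalar_prod_mult_mat_vec_sum[of _ n n]) (simp_all add: mat_sum_def)
  also have "\<dots> = (\<Sum>i<n. \<Sum>j<n. \<Sum>l\<in>I. vec_index w i * A l $$ (i, j) * vec_index v j)"
    by (simp add: sum_distrib_left sum_distrib_right)
  also have "\<dots> = (\<Sum>i<n. \<Sum>l\<in>I. \<Sum>j<n. vec_index w i * A l $$ (i, j) * vec_index v j)"
    by (intro sum.cong refl sum.swap)
  also have "\<dots> = (\<Sum>l\<in>I. \<Sum>i<n. \<Sum>j<n. vec_index w i * A l $$ (i, j) * vec_index v j)"
    by (rule sum.swap)
  also have "\<dots> = (\<Sum>l\<in>I. w \<bullet>\<^sub>v (A l *\<^sub>v v))"
    using A v by (intro sum.cong refl scalar_prod_mult_mat_vec_sum[symmetric])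
  finally show ?thesis .
qed

lemma eq_vec_scalar_prodI:
  fixes v :: "real vec"
  assumes "v \<in> carrier_vec n" "w \<in> carrier_vec n" "\<And>u. u \<in> carrier_vec n \<Longrightarrow> u \<bullet>\<^sub>v v = u \<bullet>\<^sub>v w"
  shows "v = w"
proof (rule eq_vecI)
  fix i assume "i < dim_vec w"
  then have i: "i < n" using assms(2) by simp
  show "vec_index v i = vec_index w i"
    using assms(3)[of "unit_vec n i"] assms(1,2) i by simp
qed (use assms in auto)

lemma eq_mat_mult_vecI:
  fixes A :: "real mat"
  assumes "A \<in> carrier_mat n m" "B \<in> carrier_mat n m" "\<And>v. v \<in> carrier_vec m \<Longrightarrow> A *\<^sub>v v = B *\<^sub>v v"
  shows "A = B"
proof (rule mat_col_eqI)
  fix j assume j: "j < dim_col B"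
  have "A *\<^sub>v unit_vec m j = col A j" "B *\<^sub>v unit_vec m j = col B j"
    using assms(1,2) j by (intro eq_vecI; simp)+
  then show "col A j = col B j" using assms(3)[of "unit_vec m j"] by simp
qed (use assms in auto)

text \<open>At a zero \<open>v\<close> the form is minimal. A step \<open>t w\<close> with
  \<open>w = A v\<close> changes it by \<open>2 t s + t^2 c\<close>, where
  \<open>s = w \<bullet> w\<close>, and a small negative \<open>t\<close> would make this negative
  unless \<open>s = 0\<close>.\<close>

lemma psd_form_zero_kernel:
  fixes A :: "real mat"
  assumes A: "A \<in> carrier_mat n n" "transpose_mat A = A"
    and psd: "\<And>v. v \<in> carrier_vec n \<Longrightarrow> 0 \<le> v \<bullet>\<^sub>v (A *\<^sub>v v)"
    and v: "v \<in> carrier_vec n" "v \<bullet>\<^sub>v (A *\<^sub>v v) = 0"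
  shows "A *\<^sub>v v = 0\<^sub>v n"
proof -
  define w where "w = A *\<^sub>v v"
  have w: "w \<in> carrier_vec n" using A v by (simp add: w_def)
  define s c where "s = w \<bullet>\<^sub>v w" and "c = w \<bullet>\<^sub>v (A *\<^sub>v w)"
  have "c \<ge> 0" using psd w by (simp add: c_def)
  \<comment> \<open>The minimiser would be \<open>- s / c\<close>; the denominator
    \<open>c + 1\<close> covers \<open>c = 0\<close> as well and still gives a negative value when
    \<open>s > 0\<close>.\<close>
  define t where "t = - s / (c + 1)"
  have "0 \<le> (v + t \<cdot>\<^sub>v w) \<bullet>\<^sub>v (A *\<^sub>v (v + t \<cdot>\<^sub>v w))" using psd v w by simp
  also have "A *\<^sub>v (v + t \<cdot>\<^sub>v w) = w + t \<cdot>\<^sub>v (A *\<^sub>v w)"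
    using A v w by (simp add: mult_add_distrib_mat_vec mult_mat_vec w_def)
  also have "(v + t \<cdot>\<^sub>v w) \<bullet>\<^sub>v (w + t \<cdot>\<^sub>v (A *\<^sub>v w))
      = v \<bullet>\<^sub>v w + t * (v \<bullet>\<^sub>v (A *\<^sub>v w)) + t * s + t * t * c"
    using A v w by (simp add: scalar_prod_add_distrib[of _ n] add_scalar_prod_distrib[of _ n] s_def c_def algebra_simps)
  also have "v \<bullet>\<^sub>v (A *\<^sub>v w) = s"
    using scalar_prod_mult_mat_vec_symmetric[OF A v(1) w] by (simp add: s_def w_def)
  also have "v \<bullet>\<^sub>v w = 0" using v by (simp add: w_def)
  finally have "0 \<le> 2 * t * s + t * t * c" by (simp add: mult.commute)
  have ts: "t * (c + 1) = - s" using \<open>c \<ge> 0\<close> by (simp add: t_def)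
  have "0 \<le> (c + 1)^2 * (2 * t * s + t * t * c)"
    using \<open>0 \<le> 2 * t * s + t * t * c\<close> by simp
  also have "\<dots> = 2 * (t * (c + 1)) * s * (c + 1) + (t * (c + 1)) * (t * (c + 1)) * c"
    by (simp add: algebra_simps power2_eq_square)
  also have "\<dots> = - (s^2 * (c + 2))"
    unfolding ts by (simp add: algebra_simps power2_eq_square)
  finally have "s^2 * (c + 2) \<le> 0" by simp
  then have "s = 0" using \<open>c \<ge> 0\<close> by (smt (verit) mult_pos_pos zero_less_power2)
  then show ?thesis using scalar_prod_self_eq_0[OF w] by (simp add: s_def w_def)
qed

section \<open>Affine pencils and membership in the maximal matrix convex set\<close>

definition pencil :: "nat \<Rightarrow> real \<Rightarrow> real ^ 'g \<Rightarrow> real mat ^ 'g \<Rightarrow> real mat" where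
  "pencil n a0 a X = a0 \<cdot>\<^sub>m 1\<^sub>m n + mat_sum n UNIV (\<lambda>k. a $ k \<cdot>\<^sub>m X $ k)"

definition nonneg_on :: "(real ^ 'g) set \<Rightarrow> real \<Rightarrow> real ^ 'g \<Rightarrow> bool" where
  "nonneg_on C a0 a \<longleftrightarrow> (\<forall>x\<in>C. a0 + (\<Sum>k\<in>UNIV. a $ k * x $ k) \<ge> 0)"

lemma pencil_carrier [simp]: "pencil n a0 a X \<in> carrier_mat n n"
  by (simp add: pencil_def mat_sum_def)

lemma SM_levelD:
  assumes "X \<in> SM_level n"
  shows "X $ k \<in> carrier_mat n n" "transpose_mat (X $ k) = X $ k"
  using assms by (auto simp: SM_level_def)

lemma SM_level_unique: "X \<in> SM_level n \<Longrightarrow> X \<in> SM_level m \<Longrightarrow> n = m"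
  unfolding SM_level_def by (metis (no_types, lifting) carrier_matD(1) mem_Collect_eq)

lemma scalar_prod_pencil:
  fixes X :: "real mat ^ 'g"
  assumes X: "X \<in> SM_level n" and v: "v \<in> carrier_vec n" "w \<in> carrier_vec n"
  shows "w \<bullet>\<^sub>v (pencil n a0 a X *\<^sub>v v) = a0 * (w \<bullet>\<^sub>v v) + (\<Sum>k\<in>UNIV. a $ k * (w \<bullet>\<^sub>v (X $ k *\<^sub>v v)))"
proof -
  let ?S = "mat_sum n UNIV (\<lambda>k. a $ k \<cdot>\<^sub>m X $ k)"
  note Xc = SM_levelD(1)[OF X]
  have S: "?S \<in> carrier_mat n n" by (simp add: mat_sum_def)
  have smult: "(c \<cdot>\<^sub>m A) *\<^sub>v v = c \<cdot>\<^sub>v (A *\<^sub>v v)" if "A \<in> carrier_mat n n" for c and A :: "real mat"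
    using that v by (intro eq_vecI) (auto simp: scalar_prod_def sum_distrib_left mult.assoc)
  have dots: "w \<bullet>\<^sub>v (c \<cdot>\<^sub>v (A *\<^sub>v v)) = c * (w \<bullet>\<^sub>v (A *\<^sub>v v))" if "A \<in> carrier_mat n n" for c and A :: "real mat"
    using that v by simp
  have "pencil n a0 a X *\<^sub>v v = a0 \<cdot>\<^sub>v v + ?S *\<^sub>v v"
    unfolding pencil_def using S v smult[of "1\<^sub>m n" a0] by (simp add: add_mult_distrib_mat_vec[of _ n n])
  then have "w \<bullet>\<^sub>v (pencil n a0 a X *\<^sub>v v) = a0 * (w \<bullet>\<^sub>v v) + w \<bullet>\<^sub>v (?S *\<^sub>v v)"
    using S v by (simp add: scalar_prod_add_distrib[of _ n])
  also have "w \<bullet>\<^sub>v (?S *\<^sub>v v) = (\<Sum>k\<in>UNIV. a $ k * (w \<bullet>\<^sub>v (X $ k *\<^sub>v v)))"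
    using Xc v by (subst scalar_prod_mat_sum) (auto simp: smult dots)
  finally show ?thesis .
qed

lemma transpose_pencil:
  assumes "X \<in> SM_level n"
  shows "transpose_mat (pencil n a0 a X) = pencil n a0 a X"
proof (rule eq_matI)
  fix i j assume "i < dim_row (pencil n a0 a X)" "j < dim_col (pencil n a0 a X)"
  then have ij: "i < n" "j < n" using carrier_matD[OF pencil_carrier] by metis+
  have "(X $ k) $$ (i, j) = (X $ k) $$ (j, i)" for k
    using SM_levelD[OF assms, of k] ij by (metis carrier_matD index_transpose_mat(1))
  then show "transpose_mat (pencil n a0 a X) $$ (i, j) = pencil n a0 a X $$ (i, j)"
    using ij carrier_matD[OF SM_levelD(1)[OF assms]] by (simp add: pencil_def mat_sum_def)
qed (use carrier_matD[OF pencil_carrier] in \<open>metis index_transpose_mat(2,3)\<close>)+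

text \<open>Pencils of symmetric tuples are symmetric, so positive semidefiniteness reduces to the
  sign of the quadratic form. The size of a tuple is unique, hence the union over all sizes
  contributes only the size \<open>n\<close>, and no level 0.\<close>

lemma level_Wmax_iff:
  "X \<in> level (Wmax C) n \<longleftrightarrow> 1 \<le> n \<and> X \<in> SM_level n \<and>
    (\<forall>a0 a v. nonneg_on C a0 a \<longrightarrow> v \<in> carrier_vec n \<longrightarrow> 0 \<le> v \<bullet>\<^sub>v (pencil n a0 a X *\<^sub>v v))"
proof -
  have "X \<in> level (Wmax C) n \<longleftrightarrow> 1 \<le> n \<and> X \<in> SM_level n \<and>
    (\<forall>a0 a. nonneg_on C a0 a \<longrightarrow> pos_semidef n (pencil n a0 a X))"
    unfolding level_def Wmax_def nonneg_on_def pencil_def using SM_level_unique by blast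
  also have "\<dots> \<longleftrightarrow> 1 \<le> n \<and> X \<in> SM_level n \<and>
    (\<forall>a0 a v. nonneg_on C a0 a \<longrightarrow> v \<in> carrier_vec n \<longrightarrow> 0 \<le> v \<bullet>\<^sub>v (pencil n a0 a X *\<^sub>v v))"
    unfolding pos_semidef_def using transpose_pencil by auto
  finally show ?thesis .
qed

text \<open>Divided by \<open>v \<bullet>\<^sub>v v\<close>, the form of the pencil at
  \<open>v\<close> is the scalar affine function at the joint numerical range point of
  \<open>v\<close>. Membership thus becomes a statement about points of \<open>C\<close>.\<close>

lemma Wmax_numerical_rangeI:
  fixes X :: "real mat ^ 'g"
  assumes "1 \<le> n" and X: "X \<in> SM_level n"
    and range: "\<And>v. v \<in> carrier_vec n \<Longrightarrow> v \<noteq> 0\<^sub>v n \<Longrightarrow> (\<chi> k. (v \<bullet>\<^sub>v (X $ k *\<^sub>v v)) / (v \<bullet>\<^sub>v v)) \<in> C"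
  shows "X \<in> level (Wmax C) n"
  unfolding level_Wmax_iff
proof (intro conjI allI impI assms)
  fix a0 :: real and a :: "real ^ 'g" and v :: "real vec"
  assume nn: "nonneg_on C a0 a" and v: "v \<in> carrier_vec n"
  show "0 \<le> v \<bullet>\<^sub>v (pencil n a0 a X *\<^sub>v v)"
  proof (cases "v = 0\<^sub>v n")
    case True
    have "0\<^sub>v n \<bullet>\<^sub>v (pencil n a0 a X *\<^sub>v v) = 0"
      by (rule scalar_prod_left_zero[OF mult_mat_vec_carrier[OF pencil_carrier v]])
    then show ?thesis using True by simp
  next
    case False
    then have vv: "v \<bullet>\<^sub>v v > 0"
      using scalar_prod_self_nonneg[of v] scalar_prod_self_eq_0[OF v] by fastforce
    have "0 \<le> a0 + (\<Sum>k\<in>UNIV. a $ k * ((v \<bullet>\<^sub>v (X $ k *\<^sub>v v)) / (v \<bullet>\<^sub>v v)))"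
      using nn range[OF v False] unfolding nonneg_on_def by fastforce
    then have "0 \<le> (v \<bullet>\<^sub>v v) * (a0 + (\<Sum>k\<in>UNIV. a $ k * ((v \<bullet>\<^sub>v (X $ k *\<^sub>v v)) / (v \<bullet>\<^sub>v v))))"
      using vv by simp
    also have "\<dots> = v \<bullet>\<^sub>v (pencil n a0 a X *\<^sub>v v)"
      using vv by (simp add: scalar_prod_pencil[OF X v v] distrib_left sum_distrib_left)
    finally show ?thesis .
  qed
qed

section \<open>Compressions and matrix convex combinations\<close>

lemma tuple_conj_in_SM_level:
  assumes "Y \<in> SM_level N" "V \<in> carrier_mat N n"
  shows "tuple_conj V Y \<in> SM_level n"
  unfolding SM_level_def
proof (clarify, intro conjI)
  fix k
  note Y = SM_levelD[OF assms(1), of k]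
  show "tuple_conj V Y $ k \<in> carrier_mat n n"
    using Y assms(2) by (simp add: tuple_conj_def)
  have "transpose_mat (transpose_mat V * Y $ k * V) = transpose_mat V * transpose_mat (transpose_mat V * Y $ k)"
    using Y(1) assms(2) by (intro transpose_mult[of _ n N _ n]) auto
  also have "transpose_mat (transpose_mat V * Y $ k) = Y $ k * V"
    using Y assms(2) by (subst transpose_mult[of _ n N _ N]) auto
  also have "transpose_mat V * (Y $ k * V) = transpose_mat V * Y $ k * V"
    using Y(1) assms(2) by (intro assoc_mult_mat[symmetric, of _ n N _ N _ n]) auto
  finally show "transpose_mat (tuple_conj V Y $ k) = tuple_conj V Y $ k"
    by (simp add: tuple_conj_def)
qed

lemma scalar_prod_conj:
  fixes A V :: "real mat"
  assumes "A \<in> carrier_mat N N" "V \<in> carrier_mat N n" "v \<in> carrier_vec n" "w \<in> carrier_vec n"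
  shows "w \<bullet>\<^sub>v ((transpose_mat V * A * V) *\<^sub>v v) = (V *\<^sub>v w) \<bullet>\<^sub>v (A *\<^sub>v (V *\<^sub>v v))"
proof -
  have "(transpose_mat V * A * V) *\<^sub>v v = transpose_mat V *\<^sub>v (A *\<^sub>v (V *\<^sub>v v))"
    using assms by (simp add: assoc_mult_mat_vec[of _ n N _ n] assoc_mult_mat_vec[of _ n N _ N])
  moreover have "w \<bullet>\<^sub>v (transpose_mat V *\<^sub>v y) = (V *\<^sub>v w) \<bullet>\<^sub>v y" if "y \<in> carrier_vec N" for y
    using transpose_vec_mult_scalar[of V N n w y] assms that
      comm_scalar_prod[of w n "transpose_mat V *\<^sub>v y"] comm_scalar_prod[of y N "V *\<^sub>v w"] by auto
  ultimately show ?thesis using assms by simp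
qed

lemma scalar_prod_gram:
  fixes V :: "real mat"
  assumes "V \<in> carrier_mat N n" "v \<in> carrier_vec n" "w \<in> carrier_vec n"
  shows "w \<bullet>\<^sub>v ((transpose_mat V * V) *\<^sub>v v) = (V *\<^sub>v w) \<bullet>\<^sub>v (V *\<^sub>v v)"
  using scalar_prod_conj[of "1\<^sub>m N" N V n v w] assms by simp

lemma matrix_convex_combD:
  assumes "matrix_convex_comb K n m N V Y X"
  shows "\<And>l. l < m \<Longrightarrow> Y l \<in> level K (N l)" "\<And>l. l < m \<Longrightarrow> Y l \<in> SM_level (N l)"
    "\<And>l. l < m \<Longrightarrow> V l \<in> carrier_mat (N l) n"
    "X = tuple_sum n {..<m} (\<lambda>l. tuple_conj (V l) (Y l))"
    "mat_sum n {..<m} (\<lambda>l. transpose_mat (V l) * V l) = 1\<^sub>m n"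
  using assms by (auto simp: matrix_convex_comb_def level_def)

lemma matrix_convex_comb_SM_level:
  assumes "matrix_convex_comb K n m N V Y X"
  shows "X \<in> SM_level n"
proof -
  note D = matrix_convex_combD[OF assms]
  have T: "tuple_conj (V l) (Y l) \<in> SM_level n" if "l < m" for l
    using tuple_conj_in_SM_level D that by blast
  have "(tuple_conj (V l) (Y l) $ k) $$ (j, i) = (tuple_conj (V l) (Y l) $ k) $$ (i, j)"
    if "l < m" "i < n" "j < n" for l i j k
    using SM_levelD[OF T[OF that(1)], of k] that by (metis carrier_matD index_transpose_mat(1))
  then show ?thesis
    unfolding SM_level_def D(4) by (auto simp: tuple_sum_def mat_sum_def intro!: eq_matI sum.cong)
qed

text \<open>The linear part splits by the definition of the combination, the constant part because
  the Gram matrices of the \<open>V l\<close> add up to the identity. With \<open>v = w\<close> this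
  yields matrix convexity of \<open>Wmax C\<close>, and it locates the zeros of the forms of the
  \<open>Y l\<close>.\<close>

lemma matrix_convex_comb_form:
  assumes "matrix_convex_comb K n m N V Y X" and v: "v \<in> carrier_vec n" "w \<in> carrier_vec n"
  shows "w \<bullet>\<^sub>v (pencil n a0 a X *\<^sub>v v)
    = (\<Sum>l<m. (V l *\<^sub>v w) \<bullet>\<^sub>v (pencil (N l) a0 a (Y l) *\<^sub>v (V l *\<^sub>v v)))"
proof -
  note D = matrix_convex_combD[OF assms(1)]
  have Vv: "V l *\<^sub>v v \<in> carrier_vec (N l)" "V l *\<^sub>v w \<in> carrier_vec (N l)" if "l < m" for l
    using D(3)[OF that] v by auto
  have Xk: "w \<bullet>\<^sub>v (X $ k *\<^sub>v v) = (\<Sum>l<m. (V l *\<^sub>v w) \<bullet>\<^sub>v (Y l $ k *\<^sub>v (V l *\<^sub>v v)))" for k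
  proof -
    have "tuple_conj (V l) (Y l) $ k \<in> carrier_mat n n" if "l < m" for l
      using SM_levelD(1) tuple_conj_in_SM_level D that by blast
    then have "w \<bullet>\<^sub>v (mat_sum n {..<m} (\<lambda>l. tuple_conj (V l) (Y l) $ k) *\<^sub>v v)
        = (\<Sum>l<m. w \<bullet>\<^sub>v (tuple_conj (V l) (Y l) $ k *\<^sub>v v))"
      using v(1) by (intro scalar_prod_mat_sum) auto
    then have "w \<bullet>\<^sub>v (X $ k *\<^sub>v v) = (\<Sum>l<m. w \<bullet>\<^sub>v (tuple_conj (V l) (Y l) $ k *\<^sub>v v))"
      unfolding D(4) tuple_sum_def by simp
    also have "\<dots> = (\<Sum>l<m. (V l *\<^sub>v w) \<bullet>\<^sub>v (Y l $ k *\<^sub>v (V l *\<^sub>v v)))"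
      unfolding tuple_conj_def using v SM_levelD(1)[OF D(2)] D(3)
      by (intro sum.cong refl) (simp add: scalar_prod_conj[OF SM_levelD(1)[OF D(2)] D(3)])
    finally show ?thesis .
  qed
  have "w \<bullet>\<^sub>v v = w \<bullet>\<^sub>v (1\<^sub>m n *\<^sub>v v)" using v by simp
  also have "\<dots> = (\<Sum>l<m. w \<bullet>\<^sub>v ((transpose_mat (V l) * V l) *\<^sub>v v))"
    unfolding D(5)[symmetric] using v D(3) by (intro scalar_prod_mat_sum mult_carrier_mat[OF transpose_carrier_mat[THEN iffD2]]) auto
  also have "\<dots> = (\<Sum>l<m. (V l *\<^sub>v w) \<bullet>\<^sub>v (V l *\<^sub>v v))"
    using v D(3) by (intro sum.cong refl) (simp add: scalar_prod_gram[OF D(3)])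
  finally have wv: "w \<bullet>\<^sub>v v = (\<Sum>l<m. (V l *\<^sub>v w) \<bullet>\<^sub>v (V l *\<^sub>v v))" .
  have "(\<Sum>l<m. (V l *\<^sub>v w) \<bullet>\<^sub>v (pencil (N l) a0 a (Y l) *\<^sub>v (V l *\<^sub>v v)))
    = (\<Sum>l<m. a0 * ((V l *\<^sub>v w) \<bullet>\<^sub>v (V l *\<^sub>v v))
        + (\<Sum>k\<in>UNIV. a $ k * ((V l *\<^sub>v w) \<bullet>\<^sub>v (Y l $ k *\<^sub>v (V l *\<^sub>v v)))))"
    using D(2) Vv by (intro sum.cong refl) (simp add: scalar_prod_pencil)
  also have "\<dots> = a0 * (w \<bullet>\<^sub>v v) + (\<Sum>k\<in>UNIV. a $ k * (w \<bullet>\<^sub>v (X $ k *\<^sub>v v)))"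
    unfolding wv Xk sum.distrib sum_distrib_left
    by (subst (2) sum.swap) simp
  also have "\<dots> = w \<bullet>\<^sub>v (pencil n a0 a X *\<^sub>v v)"
    using scalar_prod_pencil[OF matrix_convex_comb_SM_level[OF assms(1)] v] by simp
  finally show ?thesis by simp
qed

lemma matrix_convex_Wmax: "matrix_convex (Wmax C)"
  unfolding matrix_convex_def
proof (intro conjI allI impI)
  show "Wmax C \<subseteq> SM" unfolding Wmax_def SM_def by blast
  fix n m N V Y X
  assume n: "1 \<le> (n::nat)" and comb: "matrix_convex_comb (Wmax C) n m N V Y X"
  note D = matrix_convex_combD[OF comb]
  have "0 \<le> v \<bullet>\<^sub>v (pencil n a0 a X *\<^sub>v v)" if "nonneg_on C a0 a" "v \<in> carrier_vec n" for a0 a v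
    unfolding matrix_convex_comb_form[OF comb that(2) that(2)]
  proof (rule sum_nonneg)
    fix l assume "l \<in> {..<m}"
    then have "Y l \<in> level (Wmax C) (N l)" "V l *\<^sub>v v \<in> carrier_vec (N l)"
      using D(1) mult_mat_vec_carrier[OF D(3) that(2)] by auto
    then show "0 \<le> (V l *\<^sub>v v) \<bullet>\<^sub>v (pencil (N l) a0 a (Y l) *\<^sub>v (V l *\<^sub>v v))"
      using that(1) by (simp add: level_Wmax_iff)
  qed
  then have "X \<in> level (Wmax C) n"
    using n matrix_convex_comb_SM_level[OF comb] by (auto simp: level_Wmax_iff)
  then show "X \<in> Wmax C" by (simp add: level_def)
qed

section \<open>Kernels of wide matrices and completion of isometries\<close>

lemma wide_mat_kernel:
  fixes A :: "real mat"
  assumes A: "A \<in> carrier_mat nr nc" and "nr < nc"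
  obtains x where "x \<in> carrier_vec nc" "x \<noteq> 0\<^sub>v nc" "A *\<^sub>v x = 0\<^sub>v nr"
proof -
  \<comment> \<open>Zero rows turn \<open>A\<close> into a square matrix with the same kernel. Its
    last row is zero, so the transpose annihilates the last unit vector and the determinant
    vanishes.\<close>
  define B where "B = mat nc nc (\<lambda>(i, j). if i < nr then A $$ (i, j) else 0)"
  have B: "B \<in> carrier_mat nc nc" by (simp add: B_def)
  have "transpose_mat B *\<^sub>v unit_vec nc (nc - 1) = 0\<^sub>v nc"
    using B \<open>nr < nc\<close> by (intro eq_vecI) (auto simp: B_def)
  moreover have "unit_vec nc (nc - 1) \<noteq> (0\<^sub>v nc :: real vec)"
    using \<open>nr < nc\<close> by (metis diff_less index_unit_vec(2) index_zero_vec(1) less_nat_zero_code neq0_conv zero_less_one zero_neq_one)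
  ultimately have "Determinant.det (transpose_mat B) = 0"
    using B by (subst det_0_iff_vec_prod_zero_field[of _ nc]) (auto intro!: exI[of _ "unit_vec nc (nc - 1)"])
  then have "Determinant.det B = 0" using det_transpose[OF B] by simp
  then obtain x where x: "x \<in> carrier_vec nc" "x \<noteq> 0\<^sub>v nc" "B *\<^sub>v x = 0\<^sub>v nc"
    using det_0_iff_vec_prod_zero_field[OF B] by blast
  have "A *\<^sub>v x = 0\<^sub>v nr"
  proof (rule eq_vecI)
    fix i assume "i < dim_vec (0\<^sub>v nr :: real vec)"
    then have i: "i < nr" by simp
    have "row A i = row B i" using A i \<open>nr < nc\<close> by (intro eq_vecI) (auto simp: B_def)
    then have "vec_index (A *\<^sub>v x) i = vec_index (B *\<^sub>v x) i" using A B i \<open>nr < nc\<close> by simp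
    then show "vec_index (A *\<^sub>v x) i = vec_index (0\<^sub>v nr) i" using x(3) i \<open>nr < nc\<close> by simp
  qed (use A in auto)
  with x show thesis using that by blast
qed

lemma gram_index:
  assumes "V \<in> carrier_mat N n" "i < n" "j < n"
  shows "(transpose_mat V * V) $$ (i, j) = col V i \<bullet>\<^sub>v col V j"
  using assms by simp

text \<open>As long as \<open>n < N\<close>, the wide matrix \<open>transpose_mat W\<close> has a
  nonzero kernel vector, which is orthogonal to all columns of \<open>W\<close>. Normalised, it
  becomes one more column; the induction is on the number of missing columns.\<close>

lemma isometry_extend_orthogonal:
  fixes W :: "real mat"
  assumes "W \<in> carrier_mat N n" "transpose_mat W * W = 1\<^sub>m n" "n \<le> N"
  obtains U where "U \<in> orthogonal_mats N" "\<And>j. j < n \<Longrightarrow> col U j = col W j"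
proof -
  have "\<exists>U\<in>carrier_mat N N. transpose_mat U * U = 1\<^sub>m N \<and> (\<forall>j<n. col U j = col W j)"
    using assms
  proof (induction "N - n" arbitrary: n W)
    case 0
    then show ?case by (intro bexI[of _ W]) auto
  next
    case (Suc k)
    have "n < N" using Suc(2) by simp
    then obtain x where x: "x \<in> carrier_vec N" "x \<noteq> 0\<^sub>v N" "transpose_mat W *\<^sub>v x = 0\<^sub>v n"
      using wide_mat_kernel[of "transpose_mat W" n N] Suc(3) by auto
    then have pos: "x \<bullet>\<^sub>v x > 0"
      using scalar_prod_self_nonneg[of x] scalar_prod_self_eq_0[OF x(1)] by fastforce
    define y where "y = (1 / sqrt (x \<bullet>\<^sub>v x)) \<cdot>\<^sub>v x"
    have y: "y \<in> carrier_vec N" "y \<bullet>\<^sub>v y = 1" using x(1) pos by (simp_all add: y_def)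
    have Wx: "col W j \<bullet>\<^sub>v x = 0" if "j < n" for j
    proof -
      have "vec_index (transpose_mat W *\<^sub>v x) j = 0" using x(3) that by simp
      then show ?thesis using Suc(3) that by simp
    qed
    have Wy: "col W j \<bullet>\<^sub>v y = 0" "y \<bullet>\<^sub>v col W j = 0" if "j < n" for j
    proof -
      have c: "col W j \<in> carrier_vec N" using Suc(3) that by (intro col_carrier_vec)
      show "col W j \<bullet>\<^sub>v y = 0" using Wx[OF that] x(1) c by (simp add: y_def)
      then show "y \<bullet>\<^sub>v col W j = 0" using comm_scalar_prod[OF c y(1)] by simp
    qed
    define W' where "W' = mat N (Suc n) (\<lambda>(i, j). if j < n then W $$ (i, j) else vec_index y i)"
    have W': "W' \<in> carrier_mat N (Suc n)" by (simp add: W'_def)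
    have col1: "col W' j = col W j" if "j < n" for j
      using that Suc(3) by (intro eq_vecI) (auto simp: W'_def)
    have col2: "col W' n = y" using y(1) by (intro eq_vecI) (auto simp: W'_def)
    have WW: "col W i \<bullet>\<^sub>v col W j = (if i = j then 1 else 0)" if "i < n" "j < n" for i j
      using gram_index[OF Suc(3) that] Suc(4) that by simp
    have "transpose_mat W' * W' = 1\<^sub>m (Suc n)"
    proof (rule eq_matI)
      fix i j assume "i < dim_row (1\<^sub>m (Suc n) :: real mat)" "j < dim_col (1\<^sub>m (Suc n) :: real mat)"
      then have ij: "i < Suc n" "j < Suc n" by auto
      have "col W' i \<bullet>\<^sub>v col W' j = (if i = j then 1 else 0)"
        using ij WW Wy y(2) col1 col2 by (auto simp: less_Suc_eq)
      then show "(transpose_mat W' * W') $$ (i, j) = 1\<^sub>m (Suc n) $$ (i, j)"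
        using gram_index[OF W' ij] ij by simp
    qed (use W' in auto)
    then obtain U where "U \<in> carrier_mat N N" "transpose_mat U * U = 1\<^sub>m N" "\<forall>j<Suc n. col U j = col W' j"
      using Suc(1)[of "Suc n" W'] Suc(2) W' \<open>n < N\<close> by (metis Suc_leI diff_Suc_1 diff_Suc_eq_diff_pred diff_commute)
    then show ?case using col1 by (intro bexI[of _ U]) auto
  qed
  then obtain U where U: "U \<in> carrier_mat N N" "transpose_mat U * U = 1\<^sub>m N" "\<forall>j<n. col U j = col W j" by blast
  then have "U \<in> orthogonal_mats N"
    using mat_mult_left_right_inverse[of "transpose_mat U" N U] by (simp add: orthogonal_mats_def)
  then show thesis using that U(3) by blast
qed

text \<open>A zero of a nonnegative form of \<open>X\<close> is a zero of every summand, so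
  \<open>v\<close> lies in the kernel of the pencil of \<open>X\<close> and
  \<open>V l *\<^sub>v v\<close> in that of \<open>Y l\<close>. Applying \<open>V l\<close> to the
  first kernel equation and subtracting cancels the \<open>a0\<close> terms and leaves a linear
  condition on \<open>Y V - V X\<close>. It holds row by row, which is why \<open>rigid\<close>
  speaks about one vector for each \<open>k\<close>.\<close>

lemma convex_comb_intertwines:
  fixes X :: "real mat ^ 'g"
  assumes comb: "matrix_convex_comb (Wmax C) n m N V Y X" and X: "X \<in> level (Wmax C) n"
    and rigid: "\<And>D. (\<And>k. D k \<in> carrier_vec n) \<Longrightarrow>
      (\<And>a0 a v. nonneg_on C a0 a \<Longrightarrow> v \<in> carrier_vec n \<Longrightarrow> v \<bullet>\<^sub>v (pencil n a0 a X *\<^sub>v v) = 0 \<Longrightarrow>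
        (\<Sum>k\<in>UNIV. a $ k * (D k \<bullet>\<^sub>v v)) = 0) \<Longrightarrow> \<forall>k :: 'g. D k = 0\<^sub>v n"
    and l: "l < m"
  shows "Y l $ k * V l = V l * X $ k"
proof -
  note D = matrix_convex_combD[OF comb]
  have SX: "X \<in> SM_level n" and SY: "Y l \<in> SM_level (N l)"
    using X D(2)[OF l] by (auto simp: level_Wmax_iff)
  have V: "V l \<in> carrier_mat (N l) n" using D(3)[OF l] .
  note Xk = SM_levelD(1)[OF SX] and Yk = SM_levelD(1)[OF SY]
  define M where "M k = Y l $ k * V l - V l * X $ k" for k
  have M: "M k \<in> carrier_mat (N l) n" for k using mult_carrier_mat[OF Yk[of k] V] mult_carrier_mat[OF V Xk[of k]] minus_carrier_mat unfolding M_def by blast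
  have "row (M k) i = 0\<^sub>v n" if i: "i < N l" for k i
  proof -
    define e :: "real vec" where "e = unit_vec (N l) i"
    have e: "e \<in> carrier_vec (N l)" by (simp add: e_def)
    have adj: "(transpose_mat (V l) *\<^sub>v e) \<bullet>\<^sub>v y = e \<bullet>\<^sub>v (V l *\<^sub>v y)" if "y \<in> carrier_vec n" for y
      using transpose_vec_mult_scalar[OF V that e] .
    have "\<forall>k. row (M k) i = 0\<^sub>v n"
    proof (rule rigid)
      show "row (M k) i \<in> carrier_vec n" for k using M i by (metis row_carrier_vec)
    next
      fix a0 a v assume nn: "nonneg_on C a0 a" and v: "v \<in> carrier_vec n"
        and z: "v \<bullet>\<^sub>v (pencil n a0 a X *\<^sub>v v) = 0"
      have Vv: "V j *\<^sub>v v \<in> carrier_vec (N j)" if "j < m" for j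
        using mult_mat_vec_carrier[OF D(3)[OF that] v] .
      have nonneg: "0 \<le> (V j *\<^sub>v v) \<bullet>\<^sub>v (pencil (N j) a0 a (Y j) *\<^sub>v (V j *\<^sub>v v))" if "j < m" for j
        using D(1)[OF that] nn Vv[OF that] by (simp add: level_Wmax_iff)
      have "(V l *\<^sub>v v) \<bullet>\<^sub>v (pencil (N l) a0 a (Y l) *\<^sub>v (V l *\<^sub>v v)) = 0"
        using z l nonneg sum_nonneg_eq_0_iff[of "{..<m}" "\<lambda>j. (V j *\<^sub>v v) \<bullet>\<^sub>v (pencil (N j) a0 a (Y j) *\<^sub>v (V j *\<^sub>v v))"]
        unfolding matrix_convex_comb_form[OF comb v v] by auto
      then have "pencil (N l) a0 a (Y l) *\<^sub>v (V l *\<^sub>v v) = 0\<^sub>v (N l)"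
        using D(1)[OF l] nn Vv[OF l]
        by (intro psd_form_zero_kernel pencil_carrier transpose_pencil[OF SY]) (auto simp: level_Wmax_iff)
      then have "e \<bullet>\<^sub>v (pencil (N l) a0 a (Y l) *\<^sub>v (V l *\<^sub>v v)) = 0" using e by simp
      then have 1: "a0 * (e \<bullet>\<^sub>v (V l *\<^sub>v v)) + (\<Sum>k\<in>UNIV. a $ k * (e \<bullet>\<^sub>v (Y l $ k *\<^sub>v (V l *\<^sub>v v)))) = 0"
        using scalar_prod_pencil[OF SY Vv[OF l] e] by simp
      have "pencil n a0 a X *\<^sub>v v = 0\<^sub>v n"
        using X nn v z
        by (intro psd_form_zero_kernel pencil_carrier transpose_pencil[OF SX]) (auto simp: level_Wmax_iff)
      then have "(transpose_mat (V l) *\<^sub>v e) \<bullet>\<^sub>v (pencil n a0 a X *\<^sub>v v) = 0" using e V by simp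
      then have "a0 * ((transpose_mat (V l) *\<^sub>v e) \<bullet>\<^sub>v v)
          + (\<Sum>k\<in>UNIV. a $ k * ((transpose_mat (V l) *\<^sub>v e) \<bullet>\<^sub>v (X $ k *\<^sub>v v))) = 0"
        using scalar_prod_pencil[OF SX v, of "transpose_mat (V l) *\<^sub>v e"] V e by simp
      then have 2: "a0 * (e \<bullet>\<^sub>v (V l *\<^sub>v v)) + (\<Sum>k\<in>UNIV. a $ k * (e \<bullet>\<^sub>v (V l *\<^sub>v (X $ k *\<^sub>v v)))) = 0"
        using adj v mult_mat_vec_carrier[OF Xk v] by simp
      have "row (M k) i \<bullet>\<^sub>v v = e \<bullet>\<^sub>v (Y l $ k *\<^sub>v (V l *\<^sub>v v)) - e \<bullet>\<^sub>v (V l *\<^sub>v (X $ k *\<^sub>v v))" for k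
      proof -
        have "row (M k) i \<bullet>\<^sub>v v = e \<bullet>\<^sub>v (M k *\<^sub>v v)" using M[of k] i v by (simp add: e_def)
        also have "M k *\<^sub>v v = Y l $ k *\<^sub>v (V l *\<^sub>v v) - V l *\<^sub>v (X $ k *\<^sub>v v)"
          unfolding M_def using Xk[of k] Yk[of k] V v
          by (subst minus_mult_distrib_mat_vec[of _ "N l" n]) (auto simp: assoc_mult_mat_vec[of _ _ "N l"] assoc_mult_mat_vec[of _ _ n])
        finally show ?thesis
          using e mult_mat_vec_carrier[OF Yk Vv[OF l]] mult_mat_vec_carrier[OF V mult_mat_vec_carrier[OF Xk v]]
          by (simp add: scalar_prod_minus_distrib[of _ "N l"])
      qed
      then show "(\<Sum>k\<in>UNIV. a $ k * (row (M k) i \<bullet>\<^sub>v v)) = 0"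
        using 1 2 by (simp add: right_diff_distrib sum_subtractf)
    qed
    then show ?thesis by blast
  qed
  then have "M k = 0\<^sub>m (N l) n"
    using M[of k] by (intro eq_rowI) auto
  have "(Y l $ k * V l) $$ (i, j) = (V l * X $ k) $$ (i, j)" if "i < N l" "j < n" for i j
  proof -
    have "(Y l $ k * V l) $$ (i, j) - (V l * X $ k) $$ (i, j) = M k $$ (i, j)"
      using that Xk[of k] Yk[of k] V by (simp add: M_def del: index_mult_mat)
        (simp add: index_mult_mat(2,3))
    then show ?thesis using \<open>M k = 0\<^sub>m (N l) n\<close> that by simp
  qed
  then show ?thesis using Xk[of k] Yk[of k] V by (intro eq_matI) auto
qed

text \<open>A compression by an isometry is a matrix convex combination with a single term.\<close>

lemma tuple_conj_isometry_in_Wmax: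
  assumes "Y \<in> level (Wmax C) N" "W \<in> carrier_mat N n" "1 \<le> n" "transpose_mat W * W = 1\<^sub>m n"
  shows "tuple_conj W Y \<in> Wmax C"
proof -
  have Y: "Y \<in> SM_level N" using assms(1) by (simp add: level_def)
  have "tuple_conj W Y $ k \<in> carrier_mat n n" for k
    using SM_levelD(1)[OF tuple_conj_in_SM_level[OF Y assms(2)]] .
  then have "tuple_conj W Y = tuple_sum n {..<Suc 0} (\<lambda>l. tuple_conj W Y)"
    by (intro Finite_Cartesian_Product.vec_eq_iff[THEN iffD2] allI eq_matI) (auto simp: tuple_sum_def mat_sum_def)
  moreover have "mat_sum n {..<Suc 0} (\<lambda>l. transpose_mat W * W) = 1\<^sub>m n"
    unfolding assms(4) by (auto simp: mat_sum_def intro!: eq_matI)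
  ultimately have "matrix_convex_comb (Wmax C) n (Suc 0) (\<lambda>_. N) (\<lambda>_. W) (\<lambda>_. Y) (tuple_conj W Y)"
    unfolding matrix_convex_comb_def using assms(1,2) by blast
  then show ?thesis using matrix_convex_Wmax assms(3) unfolding matrix_convex_def by blast
qed

lemma orthogonal_mats_transpose: "U \<in> orthogonal_mats n \<Longrightarrow> transpose_mat U \<in> orthogonal_mats n"
  by (simp add: orthogonal_mats_def)

lemma isometry_dim_le:
  fixes W :: "real mat"
  assumes "W \<in> carrier_mat N n" "transpose_mat W * W = 1\<^sub>m n"
  shows "n \<le> N"
proof (rule ccontr)
  assume "\<not> n \<le> N"
  then obtain x where x: "x \<in> carrier_vec n" "x \<noteq> 0\<^sub>v n" "W *\<^sub>v x = 0\<^sub>v N"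
    using wide_mat_kernel[OF assms(1)] by auto
  have "x = (transpose_mat W * W) *\<^sub>v x" using assms(2) x(1) by simp
  also have "\<dots> = transpose_mat W *\<^sub>v (W *\<^sub>v x)"
    using assms(1) x(1) by (intro assoc_mult_mat_vec[of _ n N _ n]) auto
  also have "\<dots> = 0\<^sub>v n" using x(3) assms(1) by auto
  finally show False using x(2) by simp
qed

lemma direct_sum_in_SM_level:
  assumes "X \<in> SM_level n" "Z \<in> SM_level r"
  shows "direct_sum X Z \<in> SM_level (n + r)"
  unfolding SM_level_def
proof (clarify, intro conjI)
  fix k
  note X = SM_levelD[OF assms(1), of k] and Z = SM_levelD[OF assms(2), of k]
  show "direct_sum X Z $ k \<in> carrier_mat (n + r) (n + r)"
    using X Z by (simp add: direct_sum_def)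
  show "transpose_mat (direct_sum X Z $ k) = direct_sum X Z $ k"
    using X Z by (simp add: direct_sum_def transpose_four_block_mat[of _ n n _ r _ r])
qed

text \<open>Complete \<open>W\<close> to an orthogonal \<open>U\<close>. Because of
  \<open>YW\<close>, the first \<open>n\<close> columns of the transformed \<open>Y\<close> consist
  of \<open>X\<close> above zeros, and symmetry clears the block to the right of \<open>X\<close>.
  The remaining diagonal block is a compression of \<open>Y\<close> by the added columns and so
  belongs to \<open>Wmax C\<close>.\<close>

lemma isometric_intertwiner_summand:
  fixes X :: "real mat ^ 'g"
  assumes X: "X \<in> level (Wmax C) n" and Y: "Y \<in> level (Wmax C) N"
    and W: "W \<in> carrier_mat N n" "transpose_mat W * W = 1\<^sub>m n"
    and YW: "\<And>k. Y $ k * W = W * X $ k"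
  shows "N = n \<and> X \<sim>\<^sub>u Y \<or> n < N \<and> (\<exists>Z\<in>Wmax C. direct_sum X Z \<sim>\<^sub>u Y)"
proof -
  have SX: "X \<in> SM_level n" and SY: "Y \<in> SM_level N" and "1 \<le> n"
    using X Y by (auto simp: level_Wmax_iff)
  note Xk = SM_levelD(1)[OF SX] and Yk = SM_levelD(1)[OF SY]
  have "n \<le> N" using isometry_dim_le[OF W] .
  then obtain U where U: "U \<in> orthogonal_mats N" and colU: "\<And>j. j < n \<Longrightarrow> col U j = col W j"
    using isometry_extend_orthogonal[OF W] by metis
  have Uc: "U \<in> carrier_mat N N" and U1: "transpose_mat U * U = 1\<^sub>m N" and U2: "U * transpose_mat U = 1\<^sub>m N"
    using U by (auto simp: orthogonal_mats_def)
  \<comment> \<open>The relation asks for a conjugation that leads from \<open>T\<close> to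
    \<open>Y\<close>, whereas \<open>U\<close> leads from \<open>Y\<close> to \<open>T\<close>; the
    transpose of \<open>U\<close> reverses it.\<close>
  have conj_back: "T \<sim>\<^sub>u Y" if T: "T \<in> SM_level N" and eq: "tuple_conj U Y = T" for T
  proof -
    have "tuple_conj (transpose_mat U) T $ k = Y $ k" for k
    proof -
      have "tuple_conj (transpose_mat U) T $ k = U * (transpose_mat U * Y $ k * U) * transpose_mat U"
        unfolding eq[symmetric] by (simp add: tuple_conj_def)
      also have "\<dots> = (U * transpose_mat U) * Y $ k * (U * transpose_mat U)"
        using Uc Yk[of k] by (simp add: assoc_mult_mat[of _ N N _ N _ N])
      also have "\<dots> = Y $ k" using Yk[of k] by (simp add: U2)
      finally show ?thesis .
    qed
    then have "tuple_conj (transpose_mat U) T = Y" by (simp add: Finite_Cartesian_Product.vec_eq_iff)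
    then show ?thesis
      unfolding unitarily_equiv_def using T SY orthogonal_mats_transpose[OF U] by blast
  qed
  have conj_index: "(tuple_conj U Y $ k) $$ (i, j) = col U i \<bullet>\<^sub>v (Y $ k *\<^sub>v col U j)"
    if "i < N" "j < N" for k i j
  proof -
    have "tuple_conj U Y $ k = transpose_mat U * (Y $ k * U)"
      using Uc Yk[of k] by (simp add: tuple_conj_def assoc_mult_mat[of _ N N _ N _ N])
    moreover have "col (Y $ k * U) j = Y $ k *\<^sub>v col U j"
      using that Uc Yk[of k] by (intro col_mult2) auto
    ultimately show ?thesis using that Uc Yk[of k] by simp
  qed
  have UU: "col U i \<bullet>\<^sub>v col U j = (if i = j then 1 else 0)" if "i < N" "j < N" for i j
    using gram_index[OF Uc that] U1 that by simp
  have corner: "(tuple_conj U Y $ k) $$ (i, j) = (if i < n then (X $ k) $$ (i, j) else 0)"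
    if "i < N" "j < n" for k i j
  proof -
    have "Y $ k *\<^sub>v col U j = col (Y $ k * W) j"
      using that colU W(1) Yk[of k] \<open>n \<le> N\<close> by (simp add: col_mult2[of _ N N _ n])
    also have "\<dots> = W *\<^sub>v col (X $ k) j"
      unfolding YW using that W(1) Xk[of k] by (simp add: col_mult2[of _ N n _ n])
    finally have "(tuple_conj U Y $ k) $$ (i, j) = col U i \<bullet>\<^sub>v (W *\<^sub>v col (X $ k) j)"
      using conj_index that \<open>n \<le> N\<close> by simp
    also have "\<dots> = (transpose_mat W *\<^sub>v col U i) \<bullet>\<^sub>v col (X $ k) j"
      using that W(1) Xk[of k] Uc by (intro transpose_vec_mult_scalar[symmetric]) auto
    also have "transpose_mat W *\<^sub>v col U i = (if i < n then unit_vec n i else 0\<^sub>v n)"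
    proof (rule eq_vecI)
      fix h assume "h < dim_vec (if i < n then unit_vec n i else 0\<^sub>v n :: real vec)"
      then have h: "h < n" by (simp split: if_splits)
      have "vec_index (transpose_mat W *\<^sub>v col U i) h = col U h \<bullet>\<^sub>v col U i"
        using h W(1) colU by simp
      also have "\<dots> = vec_index (if i < n then unit_vec n i else 0\<^sub>v n) h"
        using UU[of h i] h that \<open>n \<le> N\<close> by auto
      finally show "vec_index (transpose_mat W *\<^sub>v col U i) h
        = vec_index (if i < n then unit_vec n i else 0\<^sub>v n) h" .
    qed (use W(1) in auto)
    finally have eq: "(tuple_conj U Y $ k) $$ (i, j)
        = (if i < n then unit_vec n i else 0\<^sub>v n) \<bullet>\<^sub>v col (X $ k) j" .
    have c: "col (X $ k) j \<in> carrier_vec n" using that(2) Xk[of k] by (rule col_carrier_vec)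
    show ?thesis
    proof (cases "i < n")
      case True
      then show ?thesis using eq scalar_prod_left_unit[OF c True] that(2) carrier_matD[OF Xk[of k]] by simp
    next
      case False
      then show ?thesis using eq scalar_prod_left_zero[OF c] by simp
    qed
  qed
  have conjS: "tuple_conj U Y \<in> SM_level N" using tuple_conj_in_SM_level[OF SY Uc] .
  show ?thesis
  proof (cases "N = n")
    case True
    have "tuple_conj U Y $ k = X $ k" for k
      using SM_levelD(1)[OF conjS, of k] Xk[of k] corner True by (intro eq_matI) auto
    then have "X \<sim>\<^sub>u Y" using conj_back SX True by (simp add: Finite_Cartesian_Product.vec_eq_iff)
    then show ?thesis using True by simp
  next
    case False
    then have "n < N" using \<open>n \<le> N\<close> by simp
    define r where "r = N - n"
    have r: "N = n + r" "1 \<le> r" using \<open>n < N\<close> by (auto simp: r_def)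
    define W' where "W' = mat N r (\<lambda>(i, j). U $$ (i, n + j))"
    have W': "W' \<in> carrier_mat N r" by (simp add: W'_def)
    have colW': "col W' j = col U (n + j)" if "j < r" for j
      using that Uc r by (intro eq_vecI) (auto simp: W'_def)
    have "transpose_mat W' * W' = 1\<^sub>m r"
    proof (rule eq_matI)
      fix i j assume "i < dim_row (1\<^sub>m r :: real mat)" "j < dim_col (1\<^sub>m r :: real mat)"
      then have ij: "i < r" "j < r" by auto
      show "(transpose_mat W' * W') $$ (i, j) = 1\<^sub>m r $$ (i, j)"
        using gram_index[OF W' ij] colW'[OF ij(1)] colW'[OF ij(2)] UU[of "n + i" "n + j"] ij r(1) by simp
    qed (use W' in auto)
    define Z where "Z = tuple_conj W' Y"
    have Z: "Z \<in> Wmax C"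
      unfolding Z_def using tuple_conj_isometry_in_Wmax[OF Y W' r(2)] \<open>transpose_mat W' * W' = 1\<^sub>m r\<close> .
    have SZ: "Z \<in> SM_level r" unfolding Z_def using tuple_conj_in_SM_level[OF SY W'] .
    have Z_index: "(Z $ k) $$ (i, j) = col W' i \<bullet>\<^sub>v (Y $ k *\<^sub>v col W' j)" if "i < r" "j < r" for k i j
    proof -
      have "Z $ k = transpose_mat W' * (Y $ k * W')"
        using W' Yk[of k] by (simp add: Z_def tuple_conj_def assoc_mult_mat[of _ r N _ N _ r])
      moreover have "col (Y $ k * W') j = Y $ k *\<^sub>v col W' j"
        using that W' Yk[of k] by (intro col_mult2) auto
      ultimately show ?thesis using that W' Yk[of k] by simp
    qed
    have "tuple_conj U Y $ k = direct_sum X Z $ k" for k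
    proof (rule eq_matI)
      note S = SM_levelD[OF conjS, of k] and Zk = SM_levelD(1)[OF SZ, of k]
      fix i j assume "i < dim_row (direct_sum X Z $ k)" "j < dim_col (direct_sum X Z $ k)"
      then have ij: "i < N" "j < N"
        using SM_levelD(1)[OF direct_sum_in_SM_level[OF SX SZ], of k] r by auto
      \<comment> \<open>\<open>corner\<close> describes the first \<open>n\<close> columns only;
        this carries it over to the first \<open>n\<close> rows.\<close>
      have sym: "(tuple_conj U Y $ k) $$ (i, j) = (tuple_conj U Y $ k) $$ (j, i)"
        using S ij by (metis carrier_matD index_transpose_mat(1))
      have ds: "(direct_sum X Z $ k) $$ (i, j) = (if i < n then if j < n then (X $ k) $$ (i, j) else 0
          else if j < n then 0 else (Z $ k) $$ (i - n, j - n))"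
        using Xk[of k] Zk ij r by (auto simp: direct_sum_def)
      show "(tuple_conj U Y $ k) $$ (i, j) = (direct_sum X Z $ k) $$ (i, j)"
      proof (cases "i < n \<or> j < n")
        case True
        then show ?thesis
        proof (cases "j < n")
          case True
          then show ?thesis using ds corner[OF ij(1) True, of k] by simp
        next
          case F: False
          then have "i < n" using \<open>i < n \<or> j < n\<close> by simp
          then show ?thesis using ds corner[OF ij(2) \<open>i < n\<close>, of k] F sym by simp
        qed
      next
        case F: False
        have l: "i - n < r" "j - n < r" "n + (i - n) = i" "n + (j - n) = j" using F ij r by auto
        show ?thesis
          using F ds conj_index[OF ij, of k] Z_index[OF l(1,2), of k] colW'[OF l(1)] colW'[OF l(2)] l(3,4)
          by simp
      qed
    qed (use SM_levelD(1)[OF conjS, of k] SM_levelD(1)[OF direct_sum_in_SM_level[OF SX SZ], of k] r in auto)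
    then have "tuple_conj U Y = direct_sum X Z" by (simp add: Finite_Cartesian_Product.vec_eq_iff)
    then have "direct_sum X Z \<sim>\<^sub>u Y" using conj_back direct_sum_in_SM_level[OF SX SZ] r by simp
    then show ?thesis using Z \<open>n < N\<close> by blast
  qed
qed

lemma free_extreme_point_WmaxI:
  fixes X :: "real mat ^ 'g"
  assumes X: "X \<in> level (Wmax C) n"
    and irred: "\<And>B. B \<in> carrier_mat n n \<Longrightarrow> transpose_mat B = B \<Longrightarrow> (\<And>k. B * X $ k = X $ k * B) \<Longrightarrow>
      \<exists>c. B = c \<cdot>\<^sub>m 1\<^sub>m n"
    and rigid: "\<And>D. (\<And>k. D k \<in> carrier_vec n) \<Longrightarrow>
      (\<And>a0 a v. nonneg_on C a0 a \<Longrightarrow> v \<in> carrier_vec n \<Longrightarrow> v \<bullet>\<^sub>v (pencil n a0 a X *\<^sub>v v) = 0 \<Longrightarrow>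
        (\<Sum>k\<in>UNIV. a $ k * (D k \<bullet>\<^sub>v v)) = 0) \<Longrightarrow> \<forall>k :: 'g. D k = 0\<^sub>v n"
  shows "free_extreme_point (Wmax C) n X"
  unfolding free_extreme_point_def
proof (intro conjI matrix_convex_Wmax X allI impI)
  fix m N V Y l
  assume "matrix_convex_comb (Wmax C) n m N V Y X \<and> (\<forall>l<m. V l \<noteq> 0\<^sub>m (N l) n)" and l: "l < m"
  then have comb: "matrix_convex_comb (Wmax C) n m N V Y X" and V0: "V l \<noteq> 0\<^sub>m (N l) n" by auto
  have Y: "Y l \<in> level (Wmax C) (N l)" and V: "V l \<in> carrier_mat (N l) n"
    using matrix_convex_combD[OF comb] l by auto
  have SX: "X \<in> SM_level n" and SY: "Y l \<in> SM_level (N l)" using X Y by (auto simp: level_def)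
  note Xk = SM_levelD[OF SX] and Yk = SM_levelD[OF SY]
  have YV: "Y l $ k * V l = V l * X $ k" for k
    by (rule convex_comb_intertwines[OF comb X rigid l])
  define B where "B = transpose_mat (V l) * V l"
  have B: "B \<in> carrier_mat n n" "transpose_mat B = B"
    using V by (auto simp: B_def transpose_mult[of _ n "N l" _ n])
  have conj: "tuple_conj (V l) (Y l) $ k = B * X $ k" for k
    using V Xk(1)[of k] Yk(1)[of k] YV[of k]
    by (simp add: tuple_conj_def B_def assoc_mult_mat[of _ n "N l" _ "N l" _ n] assoc_mult_mat[of _ n "N l" _ n _ n])
  \<comment> \<open>By \<open>conj\<close>, \<open>B * X $ k\<close> is a compression of a symmetric
    matrix, hence symmetric, and its transpose is \<open>X $ k * B\<close>.\<close>
  have "B * X $ k = X $ k * B" for k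
  proof -
    have "transpose_mat (B * X $ k) = B * X $ k"
      unfolding conj[symmetric] using SM_levelD(2)[OF tuple_conj_in_SM_level[OF SY V]] .
    then show ?thesis using transpose_mult[OF B(1) Xk(1)[of k]] B(2) Xk(2)[of k] by simp
  qed
  then obtain c where c: "B = c \<cdot>\<^sub>m 1\<^sub>m n" using irred[OF B] by blast
  have form: "(V l *\<^sub>v x) \<bullet>\<^sub>v (V l *\<^sub>v x) = c * (x \<bullet>\<^sub>v x)" if x: "x \<in> carrier_vec n" for x
  proof -
    have "(c \<cdot>\<^sub>m 1\<^sub>m n) *\<^sub>v x = c \<cdot>\<^sub>v x" using x by (intro eq_vecI) (auto simp: row_smult)
    then show ?thesis using scalar_prod_gram[OF V x x] x by (simp add: B_def[symmetric] c)
  qed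
  \<comment> \<open>The squared length of \<open>V l *\<^sub>v x\<close> is \<open>c\<close> times
    that of \<open>x\<close>, so \<open>c \<le> 0\<close> would make the nonzero matrix
    \<open>V l\<close> vanish. Positivity permits the rescaling to the isometry
    \<open>W\<close>.\<close>
  have "c > 0"
  proof (rule ccontr)
    assume "\<not> c > 0"
    have "V l *\<^sub>v x = 0\<^sub>m (N l) n *\<^sub>v x" if x: "x \<in> carrier_vec n" for x
    proof -
      have "c * (x \<bullet>\<^sub>v x) \<le> 0"
        using \<open>\<not> c > 0\<close> scalar_prod_self_nonneg[of x] by (simp add: mult_nonpos_nonneg)
      then have "(V l *\<^sub>v x) \<bullet>\<^sub>v (V l *\<^sub>v x) = 0"
        using form[OF x] scalar_prod_self_nonneg[of "V l *\<^sub>v x"] by simp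
      then have "V l *\<^sub>v x = 0\<^sub>v (N l)"
        using scalar_prod_self_eq_0 mult_mat_vec_carrier[OF V x] by blast
      then show ?thesis using x by auto
    qed
    then show False using V0 eq_mat_mult_vecI[OF V] by auto
  qed
  define W where "W = (1 / sqrt c) \<cdot>\<^sub>m V l"
  have W: "W \<in> carrier_mat (N l) n" using V by (simp add: W_def)
  have "transpose_mat W * W = (1 / sqrt c * (1 / sqrt c)) \<cdot>\<^sub>m B"
  proof -
    have "transpose_mat W = (1 / sqrt c) \<cdot>\<^sub>m transpose_mat (V l)" by (auto simp: W_def intro!: eq_matI)
    then have "transpose_mat W * W = (1 / sqrt c) \<cdot>\<^sub>m ((1 / sqrt c) \<cdot>\<^sub>m B)"
      using V unfolding W_def B_def
      by (simp add: mult_smult_assoc_mat[of _ n "N l" _ n] mult_smult_distrib[of _ n "N l" _ n])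
    then show ?thesis by (auto intro!: eq_matI)
  qed
  also have "\<dots> = 1\<^sub>m n" using \<open>c > 0\<close> unfolding c by (intro eq_matI) auto
  finally have WW: "transpose_mat W * W = 1\<^sub>m n" .
  have "Y l $ k * W = W * X $ k" for k
    using V Xk(1)[of k] Yk(1)[of k] YV[of k] unfolding W_def
    by (simp add: mult_smult_assoc_mat[of _ "N l" n] mult_smult_distrib[of _ "N l" "N l"])
  then show "N l = n \<and> X \<sim>\<^sub>u Y l \<or> n < N l \<and> (\<exists>Z\<in>Wmax C. direct_sum X Z \<sim>\<^sub>u Y l)"
    by (rule isometric_intertwiner_summand[OF X Y W WW])
qed

section \<open>Pairs of symmetric 2 by 2 matrices\<close>

definition sym2 :: "real \<Rightarrow> real \<Rightarrow> real \<Rightarrow> real mat" where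
  "sym2 a b c = Matrix.mat 2 2 (\<lambda>(i, j). if i \<noteq> j then b else if i = 0 then a else c)"

definition vec2 :: "real \<Rightarrow> real \<Rightarrow> real Matrix.vec" where
  "vec2 x y = Matrix.vec 2 (\<lambda>i. if i = 0 then x else y)"

lemma sym2_carrier [simp]: "sym2 a b c \<in> carrier_mat 2 2"
  by (simp add: sym2_def)

lemma vec2_carrier [simp]: "vec2 x y \<in> carrier_vec 2"
  by (simp add: vec2_def)

lemma transpose_sym2 [simp]: "transpose_mat (sym2 a b c) = sym2 a b c"
  by (intro eq_matI) (auto simp: sym2_def)

lemma vec2_cases:
  assumes "v \<in> carrier_vec 2"
  obtains x y where "v = vec2 x y"
proof
  show "v = vec2 (vec_index v 0) (vec_index v 1)"
    using assms by (intro eq_vecI) (auto simp: vec2_def less_2_cases_iff)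
qed

lemma vec2_eq_iff [simp]: "vec2 x y = vec2 x' y' \<longleftrightarrow> x = x' \<and> y = y'"
proof
  assume "vec2 x y = vec2 x' y'"
  then have "vec_index (vec2 x y) 0 = vec_index (vec2 x' y') 0"
    "vec_index (vec2 x y) 1 = vec_index (vec2 x' y') 1" by simp_all
  then show "x = x' \<and> y = y'" by (simp add: vec2_def)
qed simp

lemma zero_vec2: "0\<^sub>v 2 = vec2 0 0"
  by (intro eq_vecI) (auto simp: vec2_def)

lemma scalar_prod_vec2 [simp]: "vec2 x y \<bullet>\<^sub>v vec2 x' y' = x * x' + y * y'"
  by (simp add: vec2_def scalar_prod_def numeral_2_eq_2)

lemma sym2_mult_vec2 [simp]: "sym2 a b c *\<^sub>v vec2 x y = vec2 (a * x + b * y) (b * x + c * y)"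
  by (intro eq_vecI) (auto simp: sym2_def vec2_def scalar_prod_def numeral_2_eq_2)

lemma sym2_scalar: "sym2 a 0 a = a \<cdot>\<^sub>m 1\<^sub>m 2"
  by (intro eq_matI) (auto simp: sym2_def)

lemma sym2_cases:
  assumes "B \<in> carrier_mat 2 2" "transpose_mat B = B"
  obtains a b c where "B = sym2 a b c"
proof
  have "B $$ (1, 0) = B $$ (0, 1)"
    using assms by (metis carrier_matD index_transpose_mat(1) one_less_numeral_iff pos2 semiring_norm(76))
  then show "B = sym2 (B $$ (0, 0)) (B $$ (0, 1)) (B $$ (1, 1))"
    using assms(1) by (intro eq_matI) (auto simp: sym2_def less_2_cases_iff)
qed

lemma det_sym2: "Determinant.det (sym2 a b c) = a * c - b\<^sup>2"
proof -
  have d: "mat_delete (sym2 a b c) 0 j \<in> carrier_mat 1 1" for j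
    by (simp add: mat_delete_def sym2_def)
  have "Determinant.det (sym2 a b c) = (\<Sum>j<2. sym2 a b c $$ (0, j) * cofactor (sym2 a b c) 0 j)"
    by (rule laplace_expansion_row) auto
  also have "\<dots> = a * c - b\<^sup>2"
    using det_single[OF d]
    by (simp add: numeral_2_eq_2 cofactor_def) (simp add: mat_delete_def sym2_def power2_eq_square)
  finally show ?thesis .
qed

text \<open>The joint numerical range of this tuple is the ellipse with centre \<open>z\<close> and conjugate half-diameters
  \<open>m\<close> and \<open>n\<close>: at \<open>(cos \<phi>, sin \<phi>)\<close> its value is \<open>z + cos 2\<phi> m + sin 2\<phi> n\<close>.\<close>

definition ellipse_tuple :: "real ^ 'g \<Rightarrow> real ^ 'g \<Rightarrow> real ^ 'g \<Rightarrow> real mat ^ 'g" where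
  "ellipse_tuple z m n = (\<chi> k. sym2 (z $ k + m $ k) (n $ k) (z $ k - m $ k))"

lemma ellipse_tuple_SM_level: "ellipse_tuple z m n \<in> SM_level 2"
  by (simp add: ellipse_tuple_def SM_level_def)

lemma inner_sum: "inner a x = (\<Sum>k\<in>UNIV. a $ k * x $ k)" for a x :: "real ^ 'g"
  by (simp add: inner_vec_def)

lemma pencil_ellipse_tuple:
  "pencil 2 a0 a (ellipse_tuple z m n)
    = sym2 (a0 + inner a z + inner a m) (inner a n) (a0 + inner a z - inner a m)"
proof (rule eq_matI)
  fix i j assume "i < dim_row (sym2 (a0 + inner a z + inner a m) (inner a n) (a0 + inner a z - inner a m))"
    "j < dim_col (sym2 (a0 + inner a z + inner a m) (inner a n) (a0 + inner a z - inner a m))"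
  then have ij: "i < 2" "j < 2" by (auto simp: sym2_def)
  then show "pencil 2 a0 a (ellipse_tuple z m n) $$ (i, j)
    = sym2 (a0 + inner a z + inner a m) (inner a n) (a0 + inner a z - inner a m) $$ (i, j)"
    by (auto simp: pencil_def mat_sum_def ellipse_tuple_def sym2_def inner_sum less_2_cases_iff
        distrib_left right_diff_distrib sum.distrib sum_subtractf)
qed (simp_all add: pencil_def mat_sum_def sym2_def)

lemma irreducible_ellipse_tuple:
  fixes m n :: "real ^ 'g"
  assumes indep: "\<And>s t. s *\<^sub>R m = t *\<^sub>R n \<Longrightarrow> s = 0 \<and> t = 0"
    and B: "B \<in> carrier_mat 2 2" "transpose_mat B = B"
    and comm: "\<And>k. B * ellipse_tuple z m n $ k = ellipse_tuple z m n $ k * B"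
  shows "\<exists>c. B = c \<cdot>\<^sub>m 1\<^sub>m 2"
proof -
  obtain a b c where abc: "B = sym2 a b c" using sym2_cases[OF B] .
  \<comment> \<open>This is the off-diagonal entry of the commutator, read off by applying both
    products to the second unit vector.\<close>
  have "(2 * b) * m $ k = (a - c) * n $ k" for k
  proof -
    let ?X = "sym2 (z $ k + m $ k) (n $ k) (z $ k - m $ k)"
    have "B * ?X = ?X * B" using comm[of k] by (simp add: ellipse_tuple_def)
    then have "B *\<^sub>v (?X *\<^sub>v vec2 0 1) = ?X *\<^sub>v (B *\<^sub>v vec2 0 1)"
      using assoc_mult_mat_vec[OF B(1) sym2_carrier vec2_carrier]
        assoc_mult_mat_vec[OF sym2_carrier B(1) vec2_carrier] by metis
    then show ?thesis unfolding abc by (simp add: algebra_simps)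
  qed
  then have "(2 * b) *\<^sub>R m = (a - c) *\<^sub>R n" by (simp add: Finite_Cartesian_Product.vec_eq_iff)
  then have "b = 0" "a = c" using indep by fastforce+
  then show ?thesis using abc sym2_scalar by blast
qed

text \<open>With \<open>(- \<alpha>, - \<beta>) = \<rho> (cos 2\<phi>, sin 2\<phi>)\<close> the
  solution is \<open>sqrt \<rho> (cos \<phi>, sin \<phi>)\<close>. The minus signs are chosen so
  that \<open>(x, y)\<close> is a zero of the form of
  \<open>sym2 (\<rho> + \<alpha>) \<beta> (\<rho> - \<alpha>)\<close>, the shape of a pencil at a
  tangent line.\<close>

lemma half_angle:
  fixes \<rho> \<alpha> \<beta> :: real
  assumes "0 \<le> \<rho>" "\<alpha>\<^sup>2 + \<beta>\<^sup>2 = \<rho>\<^sup>2"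
  obtains x y where "x\<^sup>2 + y\<^sup>2 = \<rho>" "x\<^sup>2 - y\<^sup>2 = - \<alpha>" "2 * x * y = - \<beta>"
proof -
  have "\<bar>\<alpha>\<bar> \<le> \<rho>" using assms by (metis abs_le_square_iff abs_of_nonneg le_add_same_cancel1 zero_le_power2)
  then have nn: "0 \<le> (\<rho> - \<alpha>) / 2" "0 \<le> (\<rho> + \<alpha>) / 2" by auto
  define x t where "x = sqrt ((\<rho> - \<alpha>) / 2)" and "t = sqrt ((\<rho> + \<alpha>) / 2)"
  have x: "0 \<le> x" "x\<^sup>2 = (\<rho> - \<alpha>) / 2" and t: "0 \<le> t" "t\<^sup>2 = (\<rho> + \<alpha>) / 2"
    using nn by (simp_all add: x_def t_def)
  have "(2 * x * t)\<^sup>2 = 4 * x\<^sup>2 * t\<^sup>2" by (simp add: power_mult_distrib)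
  also have "\<dots> = \<bar>\<beta>\<bar>\<^sup>2" unfolding x(2) t(2) using assms(2) by (simp add: field_simps power2_eq_square)
  finally have xt: "2 * x * t = \<bar>\<beta>\<bar>" by (rule power2_eq_imp_eq) (simp_all add: x(1) t(1))
  define y where "y = (if 0 \<le> \<beta> then - t else t)"
  have "2 * x * y = - \<beta>" using xt by (simp add: y_def split: if_splits)
  moreover have "y\<^sup>2 = t\<^sup>2" by (simp add: y_def)
  ultimately show thesis using that[of x y] x t by (simp add: field_simps)
qed

text \<open>A vector \<open>(x, y)\<close> in the kernel of the pencil at a tangent determines \<open>(a \<bullet> m, a \<bullet> n)\<close> up to a factor
  as \<open>(x\<^sup>2 - y\<^sup>2, 2 x y)\<close>, so the rigidity condition at a tangent is the vanishing of a binary cubic form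
  at \<open>(x, y)\<close>, and four tangents suffice.\<close>

lemma rigid_ellipse_tuple:
  fixes z m n :: "real ^ 2" and a0 :: "nat \<Rightarrow> real" and a :: "nat \<Rightarrow> real ^ 2"
  assumes basis: "m $ 1 * n $ 2 \<noteq> m $ 2 * n $ 1"
    and nonneg: "\<And>i. i < 4 \<Longrightarrow> nonneg_on C (a0 i) (a i)"
    and pos: "\<And>i. i < 4 \<Longrightarrow> 0 < a0 i + inner (a i) z"
    and tangent: "\<And>i. i < 4 \<Longrightarrow> (inner (a i) m)\<^sup>2 + (inner (a i) n)\<^sup>2 = (a0 i + inner (a i) z)\<^sup>2"
    and distinct: "\<And>i j. i < 4 \<Longrightarrow> j < 4 \<Longrightarrow> i \<noteq> j \<Longrightarrow>
      (a0 j + inner (a j) z) * inner (a i) m \<noteq> (a0 i + inner (a i) z) * inner (a j) m \<or>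
      (a0 j + inner (a j) z) * inner (a i) n \<noteq> (a0 i + inner (a i) z) * inner (a j) n"
    and D: "\<And>k. D k \<in> carrier_vec 2"
    and zero: "\<And>a0 a v. nonneg_on C a0 a \<Longrightarrow> v \<in> carrier_vec 2 \<Longrightarrow>
        v \<bullet>\<^sub>v (pencil 2 a0 a (ellipse_tuple z m n) *\<^sub>v v) = 0 \<Longrightarrow> (\<Sum>k\<in>UNIV. a $ k * (D k \<bullet>\<^sub>v v)) = 0"
  shows "\<forall>k :: 2. D k = 0\<^sub>v 2"
proof -
  define \<rho> \<alpha> \<beta> where "\<rho> i = a0 i + inner (a i) z" and "\<alpha> i = inner (a i) m" and "\<beta> i = inner (a i) n" for i
  have "\<forall>i\<in>{..<4}. \<exists>x y. x\<^sup>2 + y\<^sup>2 = \<rho> i \<and> x\<^sup>2 - y\<^sup>2 = - \<alpha> i \<and> 2 * x * y = - \<beta> i"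
    using half_angle pos tangent unfolding \<rho>_def \<alpha>_def \<beta>_def by (metis lessThan_iff less_imp_le)
  then obtain x y where xy: "\<And>i. i < 4 \<Longrightarrow> x i ^ 2 + y i ^ 2 = \<rho> i"
    "\<And>i. i < 4 \<Longrightarrow> x i ^ 2 - y i ^ 2 = - \<alpha> i" "\<And>i. i < 4 \<Longrightarrow> 2 * x i * y i = - \<beta> i"
    by (metis lessThan_iff)
  obtain d e where D1: "D 1 = vec2 d e" using vec2_cases[OF D] .
  obtain d' e' where D2: "D 2 = vec2 d' e'" using vec2_cases[OF D] .
  define det where "det = m $ 1 * n $ 2 - m $ 2 * n $ 1"
  have "det \<noteq> 0" using basis by (simp add: det_def)
  \<comment> \<open>By Cramer's rule \<open>(E0, F0)\<close> and \<open>(E1, F1)\<close> are the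
    coordinates of \<open>(d, d')\<close> and \<open>(e, e')\<close> in the basis \<open>m\<close>,
    \<open>n\<close>. In these coordinates the direction \<open>a i\<close> enters only through
    \<open>\<alpha> i\<close> and \<open>\<beta> i\<close>.\<close>
  define E0 F0 E1 F1 where "E0 = (d * n $ 2 - d' * n $ 1) / det" and "F0 = (d' * m $ 1 - d * m $ 2) / det"
    and "E1 = (e * n $ 2 - e' * n $ 1) / det" and "F1 = (e' * m $ 1 - e * m $ 2) / det"
  have ED: "d = m $ 1 * E0 + n $ 1 * F0" "d' = m $ 2 * E0 + n $ 2 * F0"
    "e = m $ 1 * E1 + n $ 1 * F1" "e' = m $ 2 * E1 + n $ 2 * F1"
    using \<open>det \<noteq> 0\<close> unfolding E0_def F0_def E1_def F1_def
    by (simp_all add: field_simps) (simp_all add: det_def algebra_simps)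
  have cubic: "E0 * x i ^ 3 + (E1 + 2 * F0) * x i ^ 2 * y i + (2 * F1 - E0) * x i * y i ^ 2 + (- E1) * y i ^ 3 = 0"
    if i: "i < 4" for i
  proof -
    let ?v = "vec2 (x i) (y i)"
    have "?v \<bullet>\<^sub>v (pencil 2 (a0 i) (a i) (ellipse_tuple z m n) *\<^sub>v ?v)
        = \<rho> i * (x i ^ 2 + y i ^ 2) + \<alpha> i * (x i ^ 2 - y i ^ 2) + \<beta> i * (2 * x i * y i)"
      unfolding pencil_ellipse_tuple \<rho>_def \<alpha>_def \<beta>_def by (simp add: algebra_simps power2_eq_square)
    also have "\<dots> = 0"
      unfolding xy[OF i] using tangent[OF i] by (simp add: \<rho>_def \<alpha>_def \<beta>_def power2_eq_square)
    finally have "(\<Sum>k\<in>UNIV. a i $ k * (D k \<bullet>\<^sub>v ?v)) = 0"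
      using zero nonneg[OF i] by simp
    then have "a i $ 1 * (d * x i + e * y i) + a i $ 2 * (d' * x i + e' * y i) = 0"
      by (simp add: UNIV_2 D1 D2)
    then have "\<alpha> i * (E0 * x i + E1 * y i) + \<beta> i * (F0 * x i + F1 * y i) = 0"
      unfolding ED \<alpha>_def \<beta>_def by (simp add: inner_sum UNIV_2 algebra_simps)
    moreover have "\<alpha> i = y i ^ 2 - x i ^ 2" "\<beta> i = - (2 * x i * y i)" using xy[OF i] by auto
    ultimately have "(y i ^ 2 - x i ^ 2) * (E0 * x i + E1 * y i) + (- (2 * x i * y i)) * (F0 * x i + F1 * y i) = 0"
      by simp
    then show ?thesis by (simp add: algebra_simps power2_eq_square power3_eq_cube)
  qed
  \<comment> \<open>\<open>(\<alpha> i, \<beta> i) / \<rho> i\<close> depends only on the direction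
    of \<open>(x i, y i)\<close>, so parallel kernel vectors would violate
    \<open>distinct\<close>.\<close>
  have nonpar: "x i * y j \<noteq> x j * y i" if ij: "i < 4" "j < 4" "i \<noteq> j" for i j
  proof
    assume par: "x i * y j = x j * y i"
    have \<alpha>: "\<alpha> i = y i ^ 2 - x i ^ 2" "\<alpha> j = y j ^ 2 - x j ^ 2" and \<beta>: "\<beta> i = - (2 * x i * y i)" "\<beta> j = - (2 * x j * y j)"
      using xy(2,3) ij by fastforce+
    have "\<rho> j * \<alpha> i - \<rho> i * \<alpha> j = 2 * (x j * y i - x i * y j) * (x j * y i + x i * y j)"
      unfolding \<alpha> xy(1)[OF ij(1), symmetric] xy(1)[OF ij(2), symmetric] by (simp add: algebra_simps power2_eq_square)
    moreover have "\<rho> j * \<beta> i - \<rho> i * \<beta> j = 2 * (x j * y i - x i * y j) * (y i * y j - x i * x j)"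
      unfolding \<beta> xy(1)[OF ij(1), symmetric] xy(1)[OF ij(2), symmetric] by (simp add: algebra_simps power2_eq_square)
    ultimately have "\<rho> j * \<alpha> i = \<rho> i * \<alpha> j" "\<rho> j * \<beta> i = \<rho> i * \<beta> j" using par by auto
    then show False using distinct[OF ij] unfolding \<rho>_def \<alpha>_def \<beta>_def by simp
  qed
  have "E0 = 0 \<and> E1 + 2 * F0 = 0 \<and> 2 * F1 - E0 = 0 \<and> - E1 = 0"
    by (rule binary_cubic_four_zeros[OF cubic nonpar])
  then have "d = 0" "d' = 0" "e = 0" "e' = 0" using ED by auto
  then show ?thesis by (simp add: forall_2 D1 D2 zero_vec2)
qed

text \<open>The ellipse has support function
  \<open>a \<bullet> z + sqrt ((a \<bullet> m)^2 + (a \<bullet> n)^2)\<close>, so \<open>pos\<close>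
  and \<open>le\<close> say, without square roots, that it satisfies all facet inequalities. The
  joint numerical range is that ellipse.\<close>

lemma ellipse_tuple_in_Wmax:
  fixes P :: "(real ^ 2) set" and a :: "(real ^ 2) set \<Rightarrow> real ^ 2"
  assumes "polytope P" "interior P \<noteq> {}"
    and supp: "\<And>F. F facet_of P \<Longrightarrow> P \<subseteq> {x. inner (a F) x \<le> b F} \<and> F = P \<inter> {x. inner (a F) x = b F}"
    and pos: "\<And>F. F facet_of P \<Longrightarrow> 0 \<le> b F - inner (a F) z"
    and le: "\<And>F. F facet_of P \<Longrightarrow> (inner (a F) m)\<^sup>2 + (inner (a F) n)\<^sup>2 \<le> (b F - inner (a F) z)\<^sup>2"
  shows "ellipse_tuple z m n \<in> level (Wmax P) 2"
proof (rule Wmax_numerical_rangeI)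
  fix v :: "real Matrix.vec" assume v: "v \<in> carrier_vec 2" "v \<noteq> 0\<^sub>v 2"
  obtain x y where xy: "v = vec2 x y" using vec2_cases[OF v(1)] .
  let ?N = "x\<^sup>2 + y\<^sup>2"
  have N: "?N > 0" using v(2) by (auto simp: xy zero_vec2 sum_power2_gt_zero_iff)
  have point: "(\<chi> k. (v \<bullet>\<^sub>v (ellipse_tuple z m n $ k *\<^sub>v v)) / (v \<bullet>\<^sub>v v))
    = z + ((x\<^sup>2 - y\<^sup>2) / ?N) *\<^sub>R m + ((2 * x * y) / ?N) *\<^sub>R n" (is "?p = _")
  proof -
    have "(v \<bullet>\<^sub>v (ellipse_tuple z m n $ k *\<^sub>v v)) / (v \<bullet>\<^sub>v v)
      = z $ k + ((x\<^sup>2 - y\<^sup>2) / ?N) * m $ k + ((2 * x * y) / ?N) * n $ k" for k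
    proof -
      have "v \<bullet>\<^sub>v (ellipse_tuple z m n $ k *\<^sub>v v) = z $ k * ?N + (x\<^sup>2 - y\<^sup>2) * m $ k + (2 * x * y) * n $ k"
        by (simp add: xy ellipse_tuple_def algebra_simps power2_eq_square)
      moreover have "v \<bullet>\<^sub>v v = ?N" by (simp add: xy power2_eq_square)
      moreover have "z $ k * ?N / ?N = z $ k" using N by (intro nonzero_mult_div_cancel_right) linarith
      ultimately show ?thesis by (simp add: add_divide_distrib)
    qed
    then show ?thesis by (simp add: Finite_Cartesian_Product.vec_eq_iff)
  qed
  show "?p \<in> P"
    unfolding point
  proof (rule polytope_mem_facet_halfspacesI[OF assms(1,2) supp])
    fix F assume F: "F facet_of P"
    let ?c = "(x\<^sup>2 - y\<^sup>2) / ?N" and ?s = "(2 * x * y) / ?N"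
    let ?\<alpha> = "inner (a F) m" and ?\<beta> = "inner (a F) n"
    have "(x\<^sup>2 - y\<^sup>2)\<^sup>2 + (2 * x * y)\<^sup>2 = ?N\<^sup>2" by (simp add: algebra_simps power2_eq_square)
    then have "?c\<^sup>2 + ?s\<^sup>2 = ?N\<^sup>2 / ?N\<^sup>2"
      by (simp only: power_divide add_divide_distrib[symmetric])
    also have "\<dots> = 1"
      using zero_less_power[OF N, of 2] by (intro divide_self) linarith
    finally have cs: "?c\<^sup>2 + ?s\<^sup>2 = 1" .
    \<comment> \<open>Lagrange's identity, which gives the Cauchy-Schwarz inequality for the unit
      vector \<open>(?c, ?s)\<close>.\<close>
    have "(?c * ?\<alpha> + ?s * ?\<beta>)\<^sup>2 + (?c * ?\<beta> - ?s * ?\<alpha>)\<^sup>2 = (?c\<^sup>2 + ?s\<^sup>2) * (?\<alpha>\<^sup>2 + ?\<beta>\<^sup>2)"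
      by (simp only: power2_eq_square) (simp only: algebra_simps)
    then have "(?c * ?\<alpha> + ?s * ?\<beta>)\<^sup>2 \<le> ?\<alpha>\<^sup>2 + ?\<beta>\<^sup>2"
      unfolding cs by (metis le_add_same_cancel1 mult_1 zero_le_power2)
    then have "(?c * ?\<alpha> + ?s * ?\<beta>)\<^sup>2 \<le> (b F - inner (a F) z)\<^sup>2" using le[OF F] by linarith
    then have "?c * ?\<alpha> + ?s * ?\<beta> \<le> b F - inner (a F) z"
      using pos[OF F] by (rule power2_le_imp_le)
    then show "inner (a F) (z + ?c *\<^sub>R m + ?s *\<^sub>R n) \<le> b F" by (simp add: inner_add_right)
  qed
qed (simp_all add: ellipse_tuple_SM_level)

text \<open>Orthogonality of \<open>U\<close> also fixes the constant term, so the whole pencil is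
  conjugated by \<open>U\<close>. This supplies the invariant that separates the members of the
  family of ellipses.\<close>

lemma det_pencil_unitarily_equiv:
  fixes X Y :: "real mat ^ 'g"
  assumes "X \<sim>\<^sub>u Y" "X \<in> SM_level n"
  shows "Determinant.det (pencil n a0 a X) = Determinant.det (pencil n a0 a Y)"
proof -
  obtain U where U: "U \<in> carrier_mat n n" "transpose_mat U * U = 1\<^sub>m n" and Y: "tuple_conj U X = Y"
    using assms SM_level_unique unfolding unitarily_equiv_def orthogonal_mats_def by blast
  have SY: "Y \<in> SM_level n" using tuple_conj_in_SM_level[OF assms(2) U(1)] Y by simp
  let ?A = "transpose_mat U * pencil n a0 a X * U"
  have A: "?A \<in> carrier_mat n n" using U(1) by (intro mult_carrier_mat[of _ n n] mult_carrier_mat[of _ n n]) auto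
  have "w \<bullet>\<^sub>v (pencil n a0 a Y *\<^sub>v v) = w \<bullet>\<^sub>v (?A *\<^sub>v v)" if vw: "v \<in> carrier_vec n" "w \<in> carrier_vec n" for v w
  proof -
    have Uv: "U *\<^sub>v v \<in> carrier_vec n" "U *\<^sub>v w \<in> carrier_vec n" using U(1) vw by auto
    have "w \<bullet>\<^sub>v v = (U *\<^sub>v w) \<bullet>\<^sub>v (U *\<^sub>v v)" using scalar_prod_gram[OF U(1) vw] U(2) vw by simp
    moreover have "w \<bullet>\<^sub>v (Y $ k *\<^sub>v v) = (U *\<^sub>v w) \<bullet>\<^sub>v (X $ k *\<^sub>v (U *\<^sub>v v))" for k
      using scalar_prod_conj[OF SM_levelD(1)[OF assms(2)] U(1) vw] unfolding Y[symmetric] tuple_conj_def by simp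
    ultimately have "w \<bullet>\<^sub>v (pencil n a0 a Y *\<^sub>v v) = (U *\<^sub>v w) \<bullet>\<^sub>v (pencil n a0 a X *\<^sub>v (U *\<^sub>v v))"
      using scalar_prod_pencil[OF SY vw] scalar_prod_pencil[OF assms(2) Uv] by simp
    also have "\<dots> = w \<bullet>\<^sub>v (?A *\<^sub>v v)" by (rule scalar_prod_conj[OF pencil_carrier U(1) vw, symmetric])
    finally show ?thesis .
  qed
  then have "pencil n a0 a Y *\<^sub>v v = ?A *\<^sub>v v" if "v \<in> carrier_vec n" for v
    using that eq_vec_scalar_prodI[OF mult_mat_vec_carrier[OF pencil_carrier that] mult_mat_vec_carrier[OF A that]]
    by blast
  then have "pencil n a0 a Y = ?A" by (rule eq_mat_mult_vecI[OF pencil_carrier A])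
  moreover have "Determinant.det ?A = Determinant.det (transpose_mat U * U) * Determinant.det (pencil n a0 a X)"
    using U(1) by (simp add: det_mult[of _ n])
  ultimately show ?thesis by (simp add: U(2))
qed

lemma nonneg_on_iff: "nonneg_on C a0 a \<longleftrightarrow> (\<forall>x\<in>C. 0 \<le> a0 + inner a x)"
  by (simp add: nonneg_on_def inner_sum)

theorem theorem3p3:
  fixes P :: "(real ^ 2) set" and d :: nat
  assumes "convex_polygon d P" and "d \<ge> 4"
  shows "\<exists>S. infinite S \<and> (\<forall>X\<in>S. free_extreme_point (Wmax P) 2 X) \<and>
           pairwise (\<lambda>X Y. \<not> X \<sim>\<^sub>u Y) S"
proof -
  have P: "polytope P" "aff_dim P = 2" and card: "4 \<le> card {F. F facet_of P}"
    using assms by (auto simp: convex_polygon_def)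
  have poly: "polyhedron P" using P(1) polytope_imp_polyhedron by blast
  have hull: "affine hull P = UNIV" using P(2) aff_dim_eq_full[of P] by simp
  have int: "interior P \<noteq> {}"
    using P rel_interior_interior[OF hull] rel_interior_eq_empty[OF polytope_imp_convex[OF P(1)]] by force
  obtain A C F1 F2 G1 G2 where AC: "A \<in> P" "C \<in> P"
    and F12: "F1 \<noteq> F2" "{H. H facet_of P \<and> A \<in> H} = {F1, F2}"
    and G12: "G1 \<noteq> G2" "{H. H facet_of P \<and> C \<in> H} = {G1, G2}"
    and diag: "\<And>H. H facet_of P \<Longrightarrow> A \<notin> H \<or> C \<notin> H"
    by (rule polygon_diagonal[OF P card]) blast
  have "\<forall>F\<in>{F. F facet_of P}. \<exists>a b. P \<subseteq> {x. inner a x \<le> b} \<and> F = P \<inter> {x. inner a x = b}"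
    using facet_of_polyhedron[OF poly] by (metis mem_Collect_eq)
  then obtain a b where supp:
    "\<And>F. F facet_of P \<Longrightarrow> P \<subseteq> {x. inner (a F) x \<le> b F} \<and> F = P \<inter> {x. inner (a F) x = b F}"
    by (metis mem_Collect_eq)
  \<comment> \<open>Coordinates adapted to the diagonal: origin at its midpoint, axes along
    \<open>e\<close> and its rotation \<open>e'\<close> by a right angle. Then \<open>A\<close> is
    \<open>(-1, 0)\<close> and \<open>C\<close> is \<open>(1, 0)\<close>, as the tangency lemma
    requires.\<close>
  define M e where "M = (1/2) *\<^sub>R (A + C)" and "e = (1/2) *\<^sub>R (C - A)"
  define e' :: "real ^ 2" where "e' = vector [- e $ 2, e $ 1]"
  have A: "A = M - e" and C: "C = M + e"
    unfolding M_def e_def by (simp_all add: scaleR_add_right scaleR_diff_right flip: scaleR_add_left)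
  have "A \<noteq> C" using F12(2) diag by blast
  then have "e \<noteq> 0" by (simp add: e_def)
  have e'_comp: "e' $ 1 = - e $ 2" "e' $ 2 = e $ 1" by (simp_all add: e'_def)
  define E where "E = (e $ 1)\<^sup>2 + (e $ 2)\<^sup>2"
  have E: "E > 0" using \<open>e \<noteq> 0\<close>
    by (auto simp: E_def sum_power2_gt_zero_iff Finite_Cartesian_Product.vec_eq_iff forall_2)
  have coords: "x = M + (inner e (x - M) / E) *\<^sub>R e + (inner e' (x - M) / E) *\<^sub>R e'" for x
  proof -
    have "E *\<^sub>R (x - M) = inner e (x - M) *\<^sub>R e + inner e' (x - M) *\<^sub>R e'"
      by (simp add: E_def Finite_Cartesian_Product.vec_eq_iff forall_2 inner_sum UNIV_2 e'_comp
          algebra_simps power2_eq_square)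
    then have "(1 / E) *\<^sub>R (E *\<^sub>R (x - M)) = (1 / E) *\<^sub>R (inner e (x - M) *\<^sub>R e + inner e' (x - M) *\<^sub>R e')"
      by simp
    then have "x - M = (inner e (x - M) / E) *\<^sub>R e + (inner e' (x - M) / E) *\<^sub>R e'"
      using E by (simp add: scaleR_add_right)
    then show ?thesis by (simp add: algebra_simps)
  qed
  \<comment> \<open>In these coordinates the slack of the facet inequality is
    \<open>r + g x + h y\<close>. A side through \<open>A\<close> has \<open>g = r\<close> and one
    through \<open>C\<close> has \<open>g = - r\<close>; division by \<open>r\<close> brings them to
    the forms \<open>1 + x + s y\<close> and \<open>1 - x + t y\<close>.\<close>
  define r g h where "r F = b F - inner (a F) M" and "g F = - inner (a F) e" and "h F = - inner (a F) e'" for F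
  have affine: "b F - inner (a F) (M + s *\<^sub>R e + t *\<^sub>R e') = r F + s * g F + t * h F" for F s t
    by (simp add: r_def g_def h_def inner_add_right)
  have valA: "b F - inner (a F) A = r F - g F" and valC: "b F - inner (a F) C = r F + g F" for F
    using affine[of F "-1" 0] affine[of F 1 0] by (simp_all add: A C)
  have gap_nonneg: "0 \<le> b F - inner (a F) x" "b F - inner (a F) x = 0 \<longleftrightarrow> x \<in> F"
    if "F facet_of P" "x \<in> P" for F x
  proof -
    have "x \<in> F \<longleftrightarrow> x \<in> P \<and> inner (a F) x = b F" using supp[OF that(1)] by blast
    then show "b F - inner (a F) x = 0 \<longleftrightarrow> x \<in> F" using that(2) by auto
    show "0 \<le> b F - inner (a F) x" using supp[OF that(1)] that(2) by auto
  qed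
  have A_le: "0 \<le> r F - g F" "r F - g F = 0 \<longleftrightarrow> A \<in> F" if "F facet_of P" for F
    using gap_nonneg[OF that AC(1)] unfolding valA .
  have C_le: "0 \<le> r F + g F" "r F + g F = 0 \<longleftrightarrow> C \<in> F" if "F facet_of P" for F
    using gap_nonneg[OF that AC(2)] unfolding valC .
  \<comment> \<open>\<open>2 * r F\<close> is the sum of the slacks at \<open>A\<close> and
    \<open>C\<close>, and these cannot both vanish on a diagonal.\<close>
  have r_pos: "0 < r F" if "F facet_of P" for F
    using A_le[OF that] C_le[OF that] diag[OF that] by linarith
  have facetA: "F facet_of P \<and> g F = r F" if "F \<in> {F1, F2}" for F
  proof -
    have "F facet_of P" "A \<in> F" using that F12(2) by blast+
    then show ?thesis using A_le(2)[of F] by simp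
  qed
  have facetC: "F facet_of P \<and> g F = - r F" if "F \<in> {G1, G2}" for F
  proof -
    have "F facet_of P" "C \<in> F" using that G12(2) by blast+
    then show ?thesis using C_le(2)[of F] by simp
  qed
  define slope where "slope F = h F / r F" for F
  have h_slope: "h F = r F * slope F" if "F facet_of P" for F
    using r_pos[OF that] by (simp add: slope_def)
  \<comment> \<open>The hypotheses make the slack functions of \<open>F\<close> and \<open>G\<close>
    proportional, so they vanish at the same points.\<close>
  have facet_eq: "F = G" if "F facet_of P" "G facet_of P" "r G * g F = r F * g G" "slope F = slope G" for F G
  proof -
    have "r G * (b F - inner (a F) x) = r F * (b G - inner (a G) x)" for x
    proof -
      let ?s = "inner e (x - M) / E" and ?t = "inner e' (x - M) / E"
      have "r G * (r F + ?s * g F + ?t * h F) = r F * (r G + ?s * g G + ?t * h G)"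
        unfolding h_slope[OF that(1)] h_slope[OF that(2)] that(4)
        using arg_cong[OF that(3), of "\<lambda>y. ?s * y"] by (simp add: algebra_simps)
      then show ?thesis using affine coords[of x] by metis
    qed
    then have "b F - inner (a F) x = 0 \<longleftrightarrow> b G - inner (a G) x = 0" for x
      using r_pos that(1,2) by (metis less_irrefl mult_eq_0_iff)
    then have "inner (a F) x = b F \<longleftrightarrow> inner (a G) x = b G" for x
      by (metis eq_iff_diff_eq_0)
    moreover have "x \<in> H \<longleftrightarrow> x \<in> P \<and> inner (a H) x = b H" if "H facet_of P" for H x
      using supp[OF that] by blast
    ultimately show ?thesis using that(1,2) by - (rule Set.set_eqI, simp)
  qed
  define Q where "Q = (\<lambda>F. (r F, g F, h F)) ` {F. F facet_of P \<and> A \<notin> F \<and> C \<notin> F}"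
  have "finite {F. F facet_of P}" using finite_polyhedron_facets[OF poly] .
  then have finQ: "finite Q" unfolding Q_def by (rule finite_imageI[OF rev_finite_subset]) auto
  have Qlt: "\<bar>g'\<bar> < r'" if mem: "(r', g', h') \<in> Q" for r' g' h'
  proof -
    obtain F where F: "F facet_of P" "A \<notin> F" "C \<notin> F" "r' = r F" "g' = g F"
      using mem by (auto simp: Q_def)
    then show ?thesis using A_le[OF F(1)] C_le[OF F(1)] by linarith
  qed
  obtain \<delta>0 p q u w where \<delta>0: "0 < \<delta>0" and
    nondeg: "\<And>\<delta>. 0 < \<delta> \<Longrightarrow> \<delta> < \<delta>0 \<Longrightarrow> 0 < u \<delta> \<and> (w \<delta>)\<^sup>2 < u \<delta> * (\<delta> + (q \<delta>)\<^sup>2)" and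
    tangA: "\<And>\<delta> s. 0 < \<delta> \<Longrightarrow> \<delta> < \<delta>0 \<Longrightarrow> s \<in> {slope F1, slope F2} \<Longrightarrow> 0 < 1 + p \<delta> + s * q \<delta> \<and>
       u \<delta> + 2 * s * w \<delta> + s\<^sup>2 * (\<delta> + (q \<delta>)\<^sup>2) = (1 + p \<delta> + s * q \<delta>)\<^sup>2" and
    tangC: "\<And>\<delta> t. 0 < \<delta> \<Longrightarrow> \<delta> < \<delta>0 \<Longrightarrow> t \<in> {slope G1, slope G2} \<Longrightarrow> 0 < 1 - p \<delta> + t * q \<delta> \<and>
       u \<delta> - 2 * t * w \<delta> + t\<^sup>2 * (\<delta> + (q \<delta>)\<^sup>2) = (1 - p \<delta> + t * q \<delta>)\<^sup>2" and
    insideQ: "\<And>\<delta> r g h. 0 < \<delta> \<Longrightarrow> \<delta> < \<delta>0 \<Longrightarrow> (r, g, h) \<in> Q \<Longrightarrow> 0 < r + g * p \<delta> + h * q \<delta> \<and>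
       g\<^sup>2 * u \<delta> + 2 * g * h * w \<delta> + h\<^sup>2 * (\<delta> + (q \<delta>)\<^sup>2) < (r + g * p \<delta> + h * q \<delta>)\<^sup>2"
    by (rule ellipses_tangent_to_four_lines[OF finQ Qlt, where ?s1.0 = "slope F1" and ?s2.0 = "slope F2"
        and ?t1.0 = "slope G1" and ?t2.0 = "slope G2"]) (assumption | rule that)+
  \<comment> \<open>In the basis \<open>e\<close>, \<open>e'\<close> the vectors \<open>m\<close>
    and \<open>n\<close> are the columns of the Cholesky factor of the matrix with diagonal
    \<open>u\<close>, \<open>\<delta> + q^2\<close> and off-diagonal entry \<open>w\<close>. Hence
    \<open>(c \<bullet> m)^2 + (c \<bullet> n)^2\<close> is its quadratic form, as
    \<open>radius\<close> records.\<close>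
  define z m n where "z \<delta> = M + p \<delta> *\<^sub>R e + q \<delta> *\<^sub>R e'"
    and "m \<delta> = sqrt (u \<delta>) *\<^sub>R e + (w \<delta> / sqrt (u \<delta>)) *\<^sub>R e'"
    and "n \<delta> = sqrt (\<delta> + (q \<delta>)\<^sup>2 - (w \<delta>)\<^sup>2 / u \<delta>) *\<^sub>R e'" for \<delta>
  define X where "X \<delta> = ellipse_tuple (z \<delta>) (m \<delta>) (n \<delta>)" for \<delta>
  have center: "b F - inner (a F) (z \<delta>) = r F + g F * p \<delta> + h F * q \<delta>" for F \<delta>
    unfolding z_def affine by (simp add: mult.commute)
  have gap: "0 < \<delta> + (q \<delta>)\<^sup>2 - (w \<delta>)\<^sup>2 / u \<delta>" if "0 < \<delta>" "\<delta> < \<delta>0" for \<delta>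
    using nondeg[OF that] by (simp add: field_simps)
  have radius: "(inner c (m \<delta>))\<^sup>2 + (inner c (n \<delta>))\<^sup>2
      = (inner c e)\<^sup>2 * u \<delta> + 2 * inner c e * inner c e' * w \<delta> + (inner c e')\<^sup>2 * (\<delta> + (q \<delta>)\<^sup>2)"
    if "0 < \<delta>" "\<delta> < \<delta>0" for c \<delta>
  proof -
    define v where "v = sqrt (u \<delta>)"
    have v: "v > 0" "u \<delta> = v\<^sup>2" using nondeg[OF that] by (auto simp: v_def)
    have nn: "(inner c (n \<delta>))\<^sup>2 = (\<delta> + (q \<delta>)\<^sup>2 - (w \<delta>)\<^sup>2 / u \<delta>) * (inner c e')\<^sup>2"
      using gap[OF that] by (simp add: n_def power_mult_distrib)
    have mm: "inner c (m \<delta>) = v * inner c e + w \<delta> / v * inner c e'"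
      by (simp add: m_def inner_add_right v_def)
    show ?thesis
      unfolding nn mm v(2) using v(1) by (simp add: field_simps power2_eq_square)
  qed
  have tangent: "0 < r F + g F * p \<delta> + h F * q \<delta> \<and>
      (g F)\<^sup>2 * u \<delta> + 2 * g F * h F * w \<delta> + (h F)\<^sup>2 * (\<delta> + (q \<delta>)\<^sup>2) = (r F + g F * p \<delta> + h F * q \<delta>)\<^sup>2"
    if \<delta>: "0 < \<delta>" "\<delta> < \<delta>0" and F: "F \<in> {F1, F2, G1, G2}" for \<delta> F
  proof -
    consider "F \<in> {F1, F2}" | "F \<in> {G1, G2}" using F by auto
    then show ?thesis
    proof cases
      case 1
      note f = facetA[OF 1, THEN conjunct1] and gr = facetA[OF 1, THEN conjunct2]
      let ?s = "slope F"
      have t: "0 < 1 + p \<delta> + ?s * q \<delta>" "u \<delta> + 2 * ?s * w \<delta> + ?s\<^sup>2 * (\<delta> + (q \<delta>)\<^sup>2) = (1 + p \<delta> + ?s * q \<delta>)\<^sup>2"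
        using tangA[OF \<delta>, of ?s] 1 by auto
      have c: "r F + g F * p \<delta> + h F * q \<delta> = r F * (1 + p \<delta> + ?s * q \<delta>)"
        unfolding gr h_slope[OF f] by (simp add: algebra_simps)
      have "(g F)\<^sup>2 * u \<delta> + 2 * g F * h F * w \<delta> + (h F)\<^sup>2 * (\<delta> + (q \<delta>)\<^sup>2)
          = (r F)\<^sup>2 * (u \<delta> + 2 * ?s * w \<delta> + ?s\<^sup>2 * (\<delta> + (q \<delta>)\<^sup>2))"
        unfolding gr h_slope[OF f] by (simp add: algebra_simps power2_eq_square)
      then show ?thesis unfolding c t(2) using t(1) r_pos[OF f] by (simp add: power_mult_distrib)
    next
      case 2
      note f = facetC[OF 2, THEN conjunct1] and gr = facetC[OF 2, THEN conjunct2]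
      let ?s = "slope F"
      have t: "0 < 1 - p \<delta> + ?s * q \<delta>" "u \<delta> - 2 * ?s * w \<delta> + ?s\<^sup>2 * (\<delta> + (q \<delta>)\<^sup>2) = (1 - p \<delta> + ?s * q \<delta>)\<^sup>2"
        using tangC[OF \<delta>, of ?s] 2 by auto
      have c: "r F + g F * p \<delta> + h F * q \<delta> = r F * (1 - p \<delta> + ?s * q \<delta>)"
        unfolding gr h_slope[OF f] by (simp add: algebra_simps)
      have "(g F)\<^sup>2 * u \<delta> + 2 * g F * h F * w \<delta> + (h F)\<^sup>2 * (\<delta> + (q \<delta>)\<^sup>2)
          = (r F)\<^sup>2 * (u \<delta> - 2 * ?s * w \<delta> + ?s\<^sup>2 * (\<delta> + (q \<delta>)\<^sup>2))"
        unfolding gr h_slope[OF f] by (simp add: algebra_simps power2_eq_square)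
      then show ?thesis unfolding c t(2) using t(1) r_pos[OF f] by (simp add: power_mult_distrib)
    qed
  qed
  have member: "X \<delta> \<in> level (Wmax P) 2" if \<delta>: "0 < \<delta>" "\<delta> < \<delta>0" for \<delta>
  proof -
    have "0 \<le> r F + g F * p \<delta> + h F * q \<delta> \<and>
      (g F)\<^sup>2 * u \<delta> + 2 * g F * h F * w \<delta> + (h F)\<^sup>2 * (\<delta> + (q \<delta>)\<^sup>2) \<le> (r F + g F * p \<delta> + h F * q \<delta>)\<^sup>2"
      if "F facet_of P" for F
    proof (cases "A \<in> F \<or> C \<in> F")
      case True
      then have "F \<in> {F1, F2, G1, G2}" using that F12(2) G12(2) by blast
      then show ?thesis using tangent[OF \<delta>, of F] by (simp add: less_imp_le)
    next
      case False
      then have "(r F, g F, h F) \<in> Q" using that by (auto simp: Q_def)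
      then show ?thesis using insideQ[OF \<delta>] by (meson less_imp_le)
    qed
    then show ?thesis
      unfolding X_def
      by (intro ellipse_tuple_in_Wmax[OF P(1) int supp])
        (auto simp: center radius[OF \<delta>] g_def h_def)
  qed
  have extreme: "free_extreme_point (Wmax P) 2 (X \<delta>)" if \<delta>: "0 < \<delta>" "\<delta> < \<delta>0" for \<delta>
  proof -
    have "0 < sqrt (u \<delta>)" "0 < sqrt (\<delta> + (q \<delta>)\<^sup>2 - (w \<delta>)\<^sup>2 / u \<delta>)"
      using nondeg[OF \<delta>] gap[OF \<delta>] by auto
    moreover have "m \<delta> $ 1 * n \<delta> $ 2 - m \<delta> $ 2 * n \<delta> $ 1 = sqrt (u \<delta>) * sqrt (\<delta> + (q \<delta>)\<^sup>2 - (w \<delta>)\<^sup>2 / u \<delta>) * E"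
      by (simp add: m_def n_def e'_comp E_def algebra_simps power2_eq_square)
    ultimately have basis: "m \<delta> $ 1 * n \<delta> $ 2 - m \<delta> $ 2 * n \<delta> $ 1 \<noteq> 0" using E by auto
    have indep: "s = 0 \<and> t = 0" if st: "s *\<^sub>R m \<delta> = t *\<^sub>R n \<delta>" for s t
    proof -
      have "s * m \<delta> $ k = t * n \<delta> $ k" for k using arg_cong[OF st, of "\<lambda>x. x $ k"] by simp
      note k = this[of 1] this[of 2]
      have "s * (m \<delta> $ 1 * n \<delta> $ 2 - m \<delta> $ 2 * n \<delta> $ 1) = (s * m \<delta> $ 1) * n \<delta> $ 2 - (s * m \<delta> $ 2) * n \<delta> $ 1"
        by (simp add: algebra_simps)
      also have "\<dots> = 0" unfolding k by simp
      finally have s0: "s * (m \<delta> $ 1 * n \<delta> $ 2 - m \<delta> $ 2 * n \<delta> $ 1) = 0" .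
      have "t * (m \<delta> $ 1 * n \<delta> $ 2 - m \<delta> $ 2 * n \<delta> $ 1) = m \<delta> $ 1 * (t * n \<delta> $ 2) - m \<delta> $ 2 * (t * n \<delta> $ 1)"
        by (simp add: algebra_simps)
      also have "\<dots> = 0" unfolding k[symmetric] by simp
      finally have "t * (m \<delta> $ 1 * n \<delta> $ 2 - m \<delta> $ 2 * n \<delta> $ 1) = 0" .
      then show ?thesis using basis s0 by simp
    qed
    define f where "f i = (if i = 0 then F1 else if i = 1 then F2 else if i = 2 then G1 else G2)" for i :: nat
    have f_in: "f i \<in> {F1, F2, G1, G2}" for i by (simp add: f_def)
    have f_facet: "f i facet_of P" for i using f_in[of i] facetA facetC by blast
    \<comment> \<open>A common side would have both \<open>g = r\<close> and \<open>g = - r\<close>,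
      against \<open>r > 0\<close>.\<close>
    have AC_ne: "F \<noteq> G" if "F \<in> {F1, F2}" "G \<in> {G1, G2}" for F G
      using facetA[OF that(1)] facetC[OF that(2)] r_pos[of F] by auto
    have f_inj: "f i \<noteq> f j" if "i < 4" "j < 4" "i \<noteq> j" for i j
    proof -
      have "i \<in> {0, 1, 2, 3}" "j \<in> {0, 1, 2, 3}" using that by auto
      moreover have "F1 \<noteq> G1" "F1 \<noteq> G2" "F2 \<noteq> G1" "F2 \<noteq> G2" by (rule AC_ne; blast)+
      ultimately show ?thesis using that(3) F12(1) G12(1) by (auto simp: f_def)
    qed
    let ?\<rho> = "\<lambda>F. r F + g F * p \<delta> + h F * q \<delta>"
    have distinct: "?\<rho> G * inner (- a F) (m \<delta>) \<noteq> ?\<rho> F * inner (- a G) (m \<delta>) \<or>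
      ?\<rho> G * inner (- a F) (n \<delta>) \<noteq> ?\<rho> F * inner (- a G) (n \<delta>)"
      if F: "F \<in> {F1, F2, G1, G2}" and G: "G \<in> {F1, F2, G1, G2}" and "F \<noteq> G" for F G
    proof (rule ccontr)
      assume "\<not> ?thesis"
      then have eq: "?\<rho> G * inner (- a F) (m \<delta>) = ?\<rho> F * inner (- a G) (m \<delta>)"
        "?\<rho> G * inner (- a F) (n \<delta>) = ?\<rho> F * inner (- a G) (n \<delta>)" by auto
      have fac: "F facet_of P" "G facet_of P" using F G facetA facetC by blast+
      have pos: "0 < ?\<rho> F" "0 < ?\<rho> G" using tangent[OF \<delta>] F G by blast+
      define k where "k = sqrt (\<delta> + (q \<delta>)\<^sup>2 - (w \<delta>)\<^sup>2 / u \<delta>)"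
      have k: "k > 0" using gap[OF \<delta>] by (simp add: k_def)
      define v where "v = sqrt (u \<delta>)"
      have v: "v > 0" using nondeg[OF \<delta>] by (simp add: v_def)
      have inn: "inner (- a H) (n \<delta>) = k * h H" "inner (- a H) (m \<delta>) = v * g H + w \<delta> / v * h H" for H
        by (simp_all add: n_def m_def k_def v_def h_def g_def inner_add_right)
      \<comment> \<open>\<open>n\<close> has only an \<open>e'\<close> component, so the
        proportionality passes to \<open>h\<close>, then through \<open>m\<close> to
        \<open>g\<close>, and finally to \<open>r\<close>; proportional slack functions belong to
        one facet.\<close>
      have hh: "?\<rho> G * h F = ?\<rho> F * h G" using eq(2) k unfolding inn by simp
      have "v * (?\<rho> G * g F) + w \<delta> / v * (?\<rho> G * h F) = v * (?\<rho> F * g G) + w \<delta> / v * (?\<rho> F * h G)"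
        using eq(1) unfolding inn by (simp only: distrib_left mult.left_commute)
      then have gg: "?\<rho> G * g F = ?\<rho> F * g G" using v unfolding hh by simp
      have rr: "?\<rho> G * r F = ?\<rho> F * r G"
      proof -
        have "?\<rho> G * ?\<rho> F = ?\<rho> G * r F + (?\<rho> G * g F) * p \<delta> + (?\<rho> G * h F) * q \<delta>"
          "?\<rho> F * ?\<rho> G = ?\<rho> F * r G + (?\<rho> F * g G) * p \<delta> + (?\<rho> F * h G) * q \<delta>"
          by (simp_all only: distrib_left mult.assoc)
        then show ?thesis unfolding gg hh by (simp add: mult.commute)
      qed
      define c where "c = ?\<rho> F / ?\<rho> G"
      have c: "r F = c * r G" "g F = c * g G" "h F = c * h G" "c > 0"
        using rr gg hh pos unfolding c_def by (simp_all add: field_simps)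
      then have "r G * g F = r F * g G" "slope F = slope G"
        by (simp_all add: slope_def)
      then show False using facet_eq[OF fac] \<open>F \<noteq> G\<close> by blast
    qed
    show ?thesis
    proof (rule free_extreme_point_WmaxI[OF member[OF \<delta>]], goal_cases irred rigid)
      case (irred B)
      then show ?case unfolding X_def by (intro irreducible_ellipse_tuple[OF indep]) auto
    next
      case (rigid D)
      \<comment> \<open>The affine function that is nonnegative on \<open>P\<close> is the slack, so
        the rigidity lemma is used with constant term \<open>b F\<close> and direction
        \<open>- a F\<close>.\<close>
      have center': "b F + inner (- a F) (z \<delta>) = ?\<rho> F" for F using center[of F \<delta>] by simp
      show ?case
      proof (rule rigid_ellipse_tuple[where ?a0.0 = "\<lambda>i. b (f i)" and a = "\<lambda>i. - a (f i)"
            and z = "z \<delta>" and m = "m \<delta>" and n = "n \<delta>" and C = P], unfold center')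
        show "m \<delta> $ 1 * n \<delta> $ 2 \<noteq> m \<delta> $ 2 * n \<delta> $ 1" using basis by simp
        show "nonneg_on P (b (f i)) (- a (f i))" for i
          using supp[OF f_facet[of i]] by (auto simp: nonneg_on_iff)
        show "0 < ?\<rho> (f i)" for i using tangent[OF \<delta> f_in[of i]] by blast
        show "(inner (- a (f i)) (m \<delta>))\<^sup>2 + (inner (- a (f i)) (n \<delta>))\<^sup>2 = (?\<rho> (f i))\<^sup>2" for i
          using tangent[OF \<delta> f_in[of i]] radius[OF \<delta>, of "- a (f i)"] by (simp add: g_def h_def)
        show "?\<rho> (f j) * inner (- a (f i)) (m \<delta>) \<noteq> ?\<rho> (f i) * inner (- a (f j)) (m \<delta>) \<or>
          ?\<rho> (f j) * inner (- a (f i)) (n \<delta>) \<noteq> ?\<rho> (f i) * inner (- a (f j)) (n \<delta>)"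
          if "i < 4" "j < 4" "i \<noteq> j" for i j
          using distinct[OF f_in f_in f_inj[OF that]] .
      qed (use rigid in \<open>auto simp: X_def\<close>)
    qed
  qed
  \<comment> \<open>\<open>inner c (x - M)\<close> is the \<open>e'\<close> coordinate of
    \<open>x\<close>, whose range on the ellipse is centred at \<open>q\<close> with squared radius
    \<open>\<delta> + q^2\<close>. The determinant of its pencil is
    \<open>q^2 - (\<delta> + q^2) = - \<delta>\<close>.\<close>
  define c where "c = (1 / E) *\<^sub>R e'"
  have ce: "inner c e = 0" "inner c e' = 1"
  proof -
    have "inner e' e = 0" "inner e' e' = E"
      by (simp_all add: inner_sum UNIV_2 e'_comp E_def power2_eq_square)
    then show "inner c e = 0" "inner c e' = 1" using E by (simp_all add: c_def)
  qed
  have det: "Determinant.det (pencil 2 (- inner c M) c (X \<delta>)) = - \<delta>" if \<delta>: "0 < \<delta>" "\<delta> < \<delta>0" for \<delta>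
  proof -
    have "- inner c M + inner c (z \<delta>) = q \<delta>" using ce by (simp add: z_def inner_add_right)
    then have "Determinant.det (pencil 2 (- inner c M) c (X \<delta>))
        = (q \<delta>)\<^sup>2 - ((inner c (m \<delta>))\<^sup>2 + (inner c (n \<delta>))\<^sup>2)"
      unfolding X_def pencil_ellipse_tuple det_sym2 by (simp add: algebra_simps power2_eq_square)
    then show ?thesis unfolding radius[OF \<delta>] ce by simp
  qed
  \<comment> \<open>The case of equality gives injectivity of \<open>X\<close> and so infinitude;
    the case of equivalence gives pairwise inequivalence.\<close>
  have neq: "\<delta> = \<delta>'" if "0 < \<delta>" "\<delta> < \<delta>0" "0 < \<delta>'" "\<delta>' < \<delta>0" "X \<delta> = X \<delta>' \<or> X \<delta> \<sim>\<^sub>u X \<delta>'" for \<delta> \<delta>'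
  proof -
    have "X \<delta> \<in> SM_level 2" by (simp add: X_def ellipse_tuple_SM_level)
    then have "Determinant.det (pencil 2 (- inner c M) c (X \<delta>)) = Determinant.det (pencil 2 (- inner c M) c (X \<delta>'))"
      using that(5) det_pencil_unitarily_equiv by metis
    then show ?thesis using det that by simp
  qed
  have "inj_on X {0<..<\<delta>0}" using neq by (intro inj_onI) auto
  then have "infinite (X ` {0<..<\<delta>0})" using \<delta>0 finite_imageD infinite_Ioo by blast
  moreover have "\<forall>Y\<in>X ` {0<..<\<delta>0}. free_extreme_point (Wmax P) 2 Y" using extreme by auto
  moreover have "pairwise (\<lambda>X Y. \<not> X \<sim>\<^sub>u Y) (X ` {0<..<\<delta>0})"
  proof (rule pairwiseI)
    fix Y Z assume YZ: "Y \<in> X ` {0<..<\<delta>0}" "Z \<in> X ` {0<..<\<delta>0}" "Y \<noteq> Z"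
    then obtain \<delta> \<delta>' where "Y = X \<delta>" "Z = X \<delta>'" "0 < \<delta>" "\<delta> < \<delta>0" "0 < \<delta>'" "\<delta>' < \<delta>0" by auto
    then show "\<not> Y \<sim>\<^sub>u Z" using neq[of \<delta> \<delta>'] YZ(3) by auto
  qed
  ultimately show ?thesis by blast
qed

end
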